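(* For relatively prime integers $0<p<q$ let $T_{p,q}$ be the minimal Legendrian torus in $S^5$ defined in the context, and let $\lambda_1(T_{p,q})$ be the first nonzero eigenvalue of the (nonnegative) Laplacian on functions on $T_{p,q}$. (i) If $m$ and $2n$ are relatively prime (with $0<m<2n$), then $\lambda_1(T_{m,2n})<\dfrac1n$. (ii) If $2m+1$ and $2n+1$ are relatively prime (with $0<2m+1<2n+1$), then $\lambda_1(T_{2m+1,2n+1})<\dfrac{4}{2n+1}$.
   Context: Let $\operatorname{sn},\operatorname{cn},\operatorname{dn}$ be the Jacobi elliptic functions with modulus $k$ and $K(k)=\int_0^{\pi/2}(1-k^2\sin^2x)^{-1/2}dx$. For relatively prime integers $0<p<q$ put $$r^2=\frac{q+2p}{q},\qquad k^2=\frac{q^2-p^2}{q(q+2p)},\qquad c_1=\sqrt{\tfrac{q+p}{2q+p}},\quad c_2=\sqrt{\tfrac{q+p}{q+2p}},\quad c_3=\sqrt{\tfrac{q}{2q+p}},$$ with $r,k>0$, and $$u(s,t)=\Big(c_1e^{is}\operatorname{cn}(rt,k),\ i\,c_2e^{i\frac pq s}\operatorname{sn}(rt,k),\ c_3e^{-i(1+\frac pq)s}\operatorname{dn}(rt,k)\Big).$$ Then $u:\mathbb{R}^2\to S^5\subset\mathbb{C}^3$ is a conformal minimal Legendrian immersion. Its period lattice $\Lambda$ has basis $(2q\pi,0),\,(0,4K(k)/r)$ if $pq$ is even, and $(2q\pi,0),\,(q\pi,2K(k)/r)$ if $pq$ is odd. $T_{p,q}$ is the embedded minimal Legendrian torus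 given by $\mathbb{R}^2/\Lambda$, with the metric induced from $S^5$. *)

theory Defs
  imports "HOL-Analysis.Analysis"
begin

section \<open>Jacobi elliptic functions with modulus k\<close>

text \<open>The integral is oriented, so \<open>elliptic_F k \<phi>\<close> is the incomplete elliptic integral of the
  first kind for \<open>\<phi>\<close> of either sign.\<close>

definition elliptic_F :: "real \<Rightarrow> real \<Rightarrow> real" where
  "elliptic_F k \<phi> = (LBINT x=ereal 0..ereal \<phi>. 1 / sqrt (1 - k\<^sup>2 * (sin x)\<^sup>2))"

definition elliptic_K :: "real \<Rightarrow> real" where
  "elliptic_K k = elliptic_F k (pi / 2)"

text \<open>For \<open>0 \<le> k < 1\<close> the map \<open>elliptic_F k\<close> is a bijection of the real line, so that the
  amplitude is its genuine inverse; nothing is claimed for other \<open>k\<close>.\<close>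

definition jacobi_am :: "real \<Rightarrow> real \<Rightarrow> real" where
  "jacobi_am k = inv (elliptic_F k)"

definition jacobi_sn :: "real \<Rightarrow> real \<Rightarrow> real" where
  "jacobi_sn k x = sin (jacobi_am k x)"

definition jacobi_cn :: "real \<Rightarrow> real \<Rightarrow> real" where
  "jacobi_cn k x = cos (jacobi_am k x)"

definition jacobi_dn :: "real \<Rightarrow> real \<Rightarrow> real" where
  "jacobi_dn k x = sqrt (1 - k\<^sup>2 * (jacobi_sn k x)\<^sup>2)"


section \<open>The Laplacian of the torus parametrized by a doubly periodic immersion of the plane\<close>

definition partial_s :: "(real \<times> real \<Rightarrow> 'a::real_normed_vector) \<Rightarrow> real \<times> real \<Rightarrow> 'a" where
  "partial_s f = (\<lambda>(s, t). vector_derivative (\<lambda>x. f (x, t)) (at s))"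

definition partial_t :: "(real \<times> real \<Rightarrow> 'a::real_normed_vector) \<Rightarrow> real \<times> real \<Rightarrow> 'a" where
  "partial_t f = (\<lambda>(s, t). vector_derivative (\<lambda>y. f (s, y)) (at t))"

primrec C_times :: "nat \<Rightarrow> (real \<times> real \<Rightarrow> real) \<Rightarrow> bool" where
  "C_times 0 f \<longleftrightarrow> continuous_on UNIV f"
| "C_times (Suc n) f \<longleftrightarrow>
     f differentiable_on UNIV \<and> C_times n (partial_s f) \<and> C_times n (partial_t f)"

definition smooth :: "(real \<times> real \<Rightarrow> real) \<Rightarrow> bool" where
  "smooth f \<longleftrightarrow> (\<forall>n. C_times n f)"

definition period_lattice :: "(real \<times> real \<Rightarrow> 'a) \<Rightarrow> (real \<times> real) set" where
  "period_lattice u = {v. \<forall>x. u (x + v) = u x}"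

text \<open>Smooth functions on the quotient of the plane by the period lattice of \<open>u\<close>, given by their
  lifts to the plane.\<close>

definition torus_functions :: "(real \<times> real \<Rightarrow> 'a) \<Rightarrow> (real \<times> real \<Rightarrow> real) set" where
  "torus_functions u = {f. smooth f \<and> (\<forall>v\<in>period_lattice u. \<forall>x. f (x + v) = f x)}"

text \<open>Coefficients of the induced metric \<open>E ds\<^sup>2 + 2 F ds dt + G dt\<^sup>2\<close>, and the area density.\<close>

definition metric_E :: "(real \<times> real \<Rightarrow> 'a::real_inner) \<Rightarrow> real \<times> real \<Rightarrow> real" where
  "metric_E u x = partial_s u x \<bullet> partial_s u x"

definition metric_F :: "(real \<times> real \<Rightarrow> 'a::real_inner) \<Rightarrow> real \<times> real \<Rightarrow> real" where
  "metric_F u x = partial_s u x \<bullet> partial_t u x"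

definition metric_G :: "(real \<times> real \<Rightarrow> 'a::real_inner) \<Rightarrow> real \<times> real \<Rightarrow> real" where
  "metric_G u x = partial_t u x \<bullet> partial_t u x"

definition area_density :: "(real \<times> real \<Rightarrow> 'a::real_inner) \<Rightarrow> real \<times> real \<Rightarrow> real" where
  "area_density u x = sqrt (metric_E u x * metric_G u x - (metric_F u x)\<^sup>2)"

text \<open>The Laplace--Beltrami operator of the induced metric in the coordinates \<open>(s, t)\<close>, with the
  sign that makes it nonnegative: minus the divergence of the gradient.\<close>

definition laplacian ::
  "(real \<times> real \<Rightarrow> 'a::real_inner) \<Rightarrow> (real \<times> real \<Rightarrow> real) \<Rightarrow> real \<times> real \<Rightarrow> real" where
  "laplacian u f x =
     - (partial_s (\<lambda>y. (metric_G u y * partial_s f y - metric_F u y * partial_t f y)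
                         / area_density u y) x
      + partial_t (\<lambda>y. (metric_E u y * partial_t f y - metric_F u y * partial_s f y)
                         / area_density u y) x)
     / area_density u x"

definition laplace_eigenvalue :: "(real \<times> real \<Rightarrow> 'a::real_inner) \<Rightarrow> real \<Rightarrow> bool" where
  "laplace_eigenvalue u \<mu> \<longleftrightarrow>
     (\<exists>f\<in>torus_functions u. (\<exists>x. f x \<noteq> 0) \<and> (\<forall>x. laplacian u f x = \<mu> * f x))"

text \<open>On a closed surface the spectrum is discrete and nonnegative, so the nonzero eigenvalues are
  the positive ones and the infimum is a minimum.\<close>

definition first_nonzero_eigenvalue :: "(real \<times> real \<Rightarrow> 'a::real_inner) \<Rightarrow> real" where
  "first_nonzero_eigenvalue u = Inf {\<mu>. 0 < \<mu> \<and> laplace_eigenvalue u \<mu>}"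


section \<open>The minimal Legendrian tori\<close>

text \<open>Complex 3-space is \<open>complex \<times> complex \<times> complex\<close>; its inner product is the real part of the
  Hermitian product, so restricting it to tangent vectors of the unit sphere gives the metric
  of \<open>S\<^sup>5\<close>.\<close>

definition legendrian_torus :: "nat \<Rightarrow> nat \<Rightarrow> real \<times> real \<Rightarrow> complex \<times> complex \<times> complex" where
  "legendrian_torus p q = (\<lambda>(s, t).
     let P = real p; Q = real q;
         r = sqrt ((Q + 2 * P) / Q);
         k = sqrt ((Q\<^sup>2 - P\<^sup>2) / (Q * (Q + 2 * P)));
         c1 = sqrt ((Q + P) / (2 * Q + P));
         c2 = sqrt ((Q + P) / (Q + 2 * P));
         c3 = sqrt (Q / (2 * Q + P))
     in (complex_of_real c1 * cis s * complex_of_real (jacobi_cn k (r * t)),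
         \<i> * complex_of_real c2 * cis (P / Q * s) * complex_of_real (jacobi_sn k (r * t)),
         complex_of_real c3 * cis (- (1 + P / Q) * s) * complex_of_real (jacobi_dn k (r * t))))"

definition lambda1_torus :: "nat \<Rightarrow> nat \<Rightarrow> real" where
  "lambda1_torus p q = first_nonzero_eigenvalue (legendrian_torus p q)"

end

theory Submission
  imports Defs
begin

text \<open>With \<open>a = p/q\<close> the immersion is conformal with factor
  \<open>E(t) = (1 + a) - (1 - a\<^sup>2) sn\<^sup>2(r t) \<ge> a (1 + a)\<close>, so \<open>cos (\<omega> s) g(t)\<close> is an eigenfunction
  with eigenvalue \<open>\<mu>\<close> as soon as \<open>g'' = (\<omega>\<^sup>2 - \<mu> E) g\<close>. Every period of the immersion has the form
  \<open>(m q \<pi>, 2 j K(k) / r)\<close>, with \<open>m\<close> even if \<open>q\<close> is even. Hence \<open>g\<close> may be any \<open>2K(k)/r\<close>-periodic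
  solution, with \<open>\<omega> = 1/q\<close> for even \<open>q\<close> and \<open>\<omega> = 2/q\<close> for odd \<open>q\<close>. Such a solution exists for
  some \<open>0 < \<mu> \<le> \<omega>\<^sup>2 / min E\<close>, and \<open>\<omega>\<^sup>2 / (a (1 + a)) < \<omega>\<^sup>2 q / p\<close> is at most \<open>1/q\<close>, respectively
  \<open>4/q\<close>.\<close>

section \<open>Linear second-order equations\<close>

text \<open>The first eigenvalue is an infimum over positive numbers, so one eigenfunction with a
  positive eigenvalue bounds it from above. The difficulty is that g solves a Hill equation with a
  coefficient built from \<open>sn\<close> and is not given in closed form: its existence, its
  dependence on \<mu> and its smoothness all have to come from the equation. Periodicity becomes a
  boundary condition. The conformal factor is symmetric about 0 and about K(k)/r, so a solution with
  zero slope at both points is symmetric about both, hence 2K(k)/r-periodic. This leaves one real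
  condition on the one parameter \<mu>, which the intermediate value theorem can meet. If p and q
  are odd, the lattice contains the oblique period (q \<pi>, 2K(k)/r). Making each factor periodic
  on its own under the projections of the lattice deals with it; for odd q this doubles \<omega>,
  whence the 4 in the second bound.\<close>

lemma has_real_derivative_interval_integral:
  fixes f :: "real \<Rightarrow> real"
  assumes "continuous_on UNIV f"
  shows "((\<lambda>x. LBINT y=ereal 0..ereal x. f y) has_real_derivative f x) (at x)"
proof -
  \<comment> \<open>The fundamental theorem yields a derivative within a closed interval; this one
    contains 0 and has x in its interior.\<close>
  define a where "a = - \<bar>x\<bar> - 1"
  define b where "b = \<bar>x\<bar> + 1"
  have "((\<lambda>u. LBINT y=ereal 0..ereal u. f y) has_vector_derivative f x) (at x within {a..b})"
    by (rule interval_integral_FTC2)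
      (auto simp: a_def b_def intro: continuous_on_subset[OF assms, simplified])
  moreover have "at x within {a..b} = at x"
    by (rule at_within_Icc_at) (auto simp: a_def b_def)
  ultimately show ?thesis by (simp add: has_real_derivative_iff_has_vector_derivative)
qed

lemma has_real_derivative_reflect:
  fixes f :: "real \<Rightarrow> real"
  assumes "\<And>x. (f has_real_derivative f' x) (at x)"
  shows "((\<lambda>y. f (c - y)) has_real_derivative - f' (c - y)) (at y)"
proof -
  have "((\<lambda>y. c - y) has_real_derivative - 1) (at y)"
    by (auto intro!: derivative_eq_intros)
  from DERIV_chain2[where f = f, OF assms this] show ?thesis by simp
qed

text \<open>Both \<open>G - f\<close> and \<open>G + f\<close> vanish at 0 and are nondecreasing on
  the right half-line.\<close>

lemma abs_le_of_abs_deriv_le: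
  fixes f G :: "real \<Rightarrow> real"
  assumes f: "\<And>x. (f has_real_derivative f' x) (at x)"
    and G: "\<And>x. (G has_real_derivative G' x) (at x)"
    and le: "\<And>x. 0 \<le> x \<Longrightarrow> \<bar>f' x\<bar> \<le> G' x"
    and "f 0 = 0" "G 0 = 0" "0 \<le> x"
  shows "\<bar>f x\<bar> \<le> G x"
proof -
  have "(\<lambda>x. G x - f x) 0 \<le> (\<lambda>x. G x - f x) x"
  proof (rule DERIV_nonneg_imp_nondecreasing[OF \<open>0 \<le> x\<close>])
    fix y assume "0 \<le> y" "y \<le> x"
    have "((\<lambda>x. G x - f x) has_real_derivative G' y - f' y) (at y)"
      by (intro derivative_intros f G)
    then show "\<exists>d. ((\<lambda>x. G x - f x) has_real_derivative d) (at y) \<and> 0 \<le> d"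
      using le[OF \<open>0 \<le> y\<close>] by (intro exI[of _ "G' y - f' y"]) auto
  qed
  moreover have "(\<lambda>x. G x + f x) 0 \<le> (\<lambda>x. G x + f x) x"
  proof (rule DERIV_nonneg_imp_nondecreasing[OF \<open>0 \<le> x\<close>])
    fix y assume "0 \<le> y" "y \<le> x"
    have "((\<lambda>x. G x + f x) has_real_derivative G' y + f' y) (at y)"
      by (intro derivative_intros f G)
    then show "\<exists>d. ((\<lambda>x. G x + f x) has_real_derivative d) (at y) \<and> 0 \<le> d"
      using le[OF \<open>0 \<le> y\<close>] by (intro exI[of _ "G' y + f' y"]) auto
  qed
  ultimately show ?thesis using assms(4,5) by auto
qed

lemma abs_le_of_abs_deriv_le_even:
  fixes f G :: "real \<Rightarrow> real"
  assumes f: "\<And>x. (f has_real_derivative f' x) (at x)"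
    and G: "\<And>x. (G has_real_derivative G' x) (at x)"
    and le: "\<And>x. \<bar>f' x\<bar> \<le> G' \<bar>x\<bar>"
    and 0: "f 0 = 0" "G 0 = 0"
  shows "\<bar>f x\<bar> \<le> G \<bar>x\<bar>"
proof (cases "0 \<le> x")
  case True
  have "\<bar>f x\<bar> \<le> G x"
    by (rule abs_le_of_abs_deriv_le[OF f G _ 0 True]) (metis le abs_of_nonneg)
  then show ?thesis using True by simp
next
  case False
  have d: "((\<lambda>x. f (- x)) has_real_derivative - f' (- y)) (at y)" for y
    using has_real_derivative_reflect[OF f, of 0] by simp
  have "\<bar>(\<lambda>x. f (- x)) (- x)\<bar> \<le> G (- x)"
  proof (rule abs_le_of_abs_deriv_le[OF d G])
    show "\<bar>- f' (- y)\<bar> \<le> G' y" if "0 \<le> y" for y using le[of "- y"] that by simp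
  qed (use 0 False in auto)
  then show ?thesis using False by simp
qed

section \<open>The Volterra series of a second-order linear equation\<close>

primrec volterra_term :: "(real \<Rightarrow> real) \<Rightarrow> nat \<Rightarrow> real \<Rightarrow> real" where
  "volterra_term V 0 = (\<lambda>x. 1)"
| "volterra_term V (Suc n) =
     (\<lambda>x. LBINT y=ereal 0..ereal x. (LBINT z=ereal 0..ereal y. V z * volterra_term V n z))"

text \<open>The inner integral of \<open>volterra_term\<close>, that is, the derivative of the term
  with the same index. It is named because the series of these derivatives must itself be
  differentiated term by term.\<close>

fun volterra_term_deriv :: "(real \<Rightarrow> real) \<Rightarrow> nat \<Rightarrow> real \<Rightarrow> real" where
  "volterra_term_deriv V 0 = (\<lambda>x. 0)"
| "volterra_term_deriv V (Suc n) = (\<lambda>y. LBINT z=ereal 0..ereal y. V z * volterra_term V n z)"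

lemma interval_integral_0_0: "(LBINT y=ereal 0..ereal 0. f y) = (0::real)"
  by (rule interval_integral_endpoints_same)

context
  fixes V :: "real \<Rightarrow> real"
  assumes V: "continuous_on UNIV V"
begin

lemma continuous_on_volterra_term: "continuous_on UNIV (volterra_term V n)"
proof (induction n)
  case (Suc n)
  have c: "continuous_on UNIV (\<lambda>z. V z * volterra_term V n z)"
    by (intro continuous_intros V Suc)
  have "continuous_on UNIV (\<lambda>y. LBINT z=ereal 0..ereal y. V z * volterra_term V n z)"
    using has_real_derivative_interval_integral[OF c] DERIV_isCont continuous_at_imp_continuous_on
    by blast
  from has_real_derivative_interval_integral[OF this] show ?case
    using DERIV_isCont continuous_at_imp_continuous_on by (simp, blast)
qed simp

lemma volterra_term_deriv_Suc:
  "(volterra_term_deriv V (Suc n) has_real_derivative V x * volterra_term V n x) (at x)"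
  using has_real_derivative_interval_integral[of "\<lambda>z. V z * volterra_term V n z"]
    continuous_on_mult[OF V continuous_on_volterra_term] by simp

lemma volterra_term_has_deriv:
  "(volterra_term V n has_real_derivative volterra_term_deriv V n x) (at x)"
proof (cases n)
  case (Suc m)
  have "continuous_on UNIV (volterra_term_deriv V (Suc m))"
    using volterra_term_deriv_Suc DERIV_isCont continuous_at_imp_continuous_on by blast
  from has_real_derivative_interval_integral[OF this] show ?thesis by (simp add: Suc)
qed simp

text \<open>The comparison function \<open>cosh (\<beta> x)\<close> with \<open>\<beta>\<^sup>2 = 2 M\<close> makes each iteration gain
  a factor \<open>1/2\<close>.\<close>

lemma volterra_term_bounds:
  fixes \<beta> :: real
  assumes M: "\<And>x. \<bar>V x\<bar> \<le> M" and \<beta>: "\<beta> > 0" "\<beta>\<^sup>2 = 2 * M"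
  shows "\<bar>volterra_term V n x\<bar> \<le> (1/2)^n * cosh (\<beta> * x)"
    and "\<bar>volterra_term_deriv V n x\<bar> \<le> (1/2)^n * \<beta> * sinh (\<beta> * \<bar>x\<bar>)"
proof -
  have "(\<forall>x. \<bar>volterra_term V n x\<bar> \<le> (1/2)^n * cosh (\<beta> * x)) \<and>
        (\<forall>x. \<bar>volterra_term_deriv V n x\<bar> \<le> (1/2)^n * \<beta> * sinh (\<beta> * \<bar>x\<bar>))"
  proof (induction n)
    case 0
    then show ?case using \<beta> by (auto simp: cosh_real_ge_1)
  next
    case (Suc n)
    have d: "\<bar>volterra_term_deriv V (Suc n) x\<bar> \<le> (1/2)^Suc n * \<beta> * sinh (\<beta> * \<bar>x\<bar>)" for x
    proof (rule abs_le_of_abs_deriv_le_even[OF volterra_term_deriv_Suc,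
          where G' = "\<lambda>x. (1/2)^Suc n * \<beta> * (cosh (\<beta> * x) * \<beta>)"])
      show "((\<lambda>x. (1/2)^Suc n * \<beta> * sinh (\<beta> * x)) has_real_derivative
              (1/2)^Suc n * \<beta> * (cosh (\<beta> * x) * \<beta>)) (at x)" for x
        by (auto intro!: derivative_eq_intros)
      fix x
      have "\<bar>V x * volterra_term V n x\<bar> \<le> M * ((1/2)^n * cosh (\<beta> * x))"
        unfolding abs_mult using M[of x] Suc by (intro mult_mono) auto
      also have "\<dots> = (1/2)^Suc n * \<beta> * (cosh (\<beta> * \<bar>x\<bar>) * \<beta>)"
      proof -
        have cosh_abs: "cosh (\<beta> * \<bar>x\<bar>) = cosh (\<beta> * x)" by (cases "0 \<le> x") simp_all
        have "M * ((1/2)^n * cosh (\<beta> * x)) = (\<beta>\<^sup>2 / 2) * ((1/2)^n * cosh (\<beta> * x))"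
          by (simp add: \<beta>(2))
        also have "\<dots> = (1/2)^Suc n * \<beta> * (cosh (\<beta> * x) * \<beta>)"
          by (simp add: power2_eq_square)
        finally show ?thesis by (simp only: cosh_abs)
      qed
      finally show "\<bar>V x * volterra_term V n x\<bar> \<le> (1/2)^Suc n * \<beta> * (cosh (\<beta> * \<bar>x\<bar>) * \<beta>)" .
    qed (simp_all add: interval_integral_0_0)
    \<comment> \<open>The comparison function has to vanish at 0, so the estimate is proved with
      \<open>cosh - 1\<close>; the \<open>- 1\<close> is dropped afterwards.\<close>
    have "\<bar>volterra_term V (Suc n) x\<bar> \<le> (1/2)^Suc n * (cosh (\<beta> * \<bar>x\<bar>) - 1)" for x
    proof (rule abs_le_of_abs_deriv_le_even[OF volterra_term_has_deriv])
      show "((\<lambda>x. (1/2)^Suc n * (cosh (\<beta> * x) - 1)) has_real_derivative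
              (1/2)^Suc n * \<beta> * sinh (\<beta> * x)) (at x)" for x
        by (auto intro!: derivative_eq_intros)
    qed (use d in \<open>simp_all add: interval_integral_0_0\<close>)
    moreover have "(1/2)^Suc n * (cosh (\<beta> * \<bar>x\<bar>) - 1) \<le> (1/2)^Suc n * cosh (\<beta> * x)" for x
      by (intro mult_left_mono) (auto simp: abs_if)
    ultimately show ?case using d order_trans by blast
  qed
  then show "\<bar>volterra_term V n x\<bar> \<le> (1/2)^n * cosh (\<beta> * x)"
    and "\<bar>volterra_term_deriv V n x\<bar> \<le> (1/2)^n * \<beta> * sinh (\<beta> * \<bar>x\<bar>)" by auto
qed

text \<open>The solution is the sum of the iterated integrals. Their geometric bounds, uniform on
  each interval [-R, R], permit differentiating the series twice.\<close>

lemma linear_ode_exists: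
  assumes M: "\<And>x. \<bar>V x\<bar> \<le> M"
  obtains g g' where "g 0 = 1" "g' 0 = 0"
    "\<And>x. (g has_real_derivative g' x) (at x)"
    "\<And>x. (g' has_real_derivative V x * g x) (at x)"
proof -
  \<comment> \<open>Raising the bound by 1 makes it positive, so that \<open>\<beta>\<close> is
    positive even if V vanishes.\<close>
  define N where "N = M + 1"
  have N: "\<And>x. \<bar>V x\<bar> \<le> N" using M by (simp add: N_def add_increasing2)
  have "N > 0" using M[of 0] by (simp add: N_def)
  define \<beta> where "\<beta> = sqrt (2 * N)"
  have \<beta>: "\<beta> > 0" "\<beta>\<^sup>2 = 2 * N" using \<open>N > 0\<close> by (auto simp: \<beta>_def)
  let ?a = "volterra_term V" and ?b = "volterra_term_deriv V"
  define g where "g = (\<lambda>x. \<Sum>n. ?a n x)"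
  define g' where "g' = (\<lambda>x. \<Sum>n. ?b n x)"
  note bnd = volterra_term_bounds[OF N \<beta>]
  have cosh_mono: "cosh (\<beta> * x) \<le> cosh (\<beta> * R)" if "\<bar>x\<bar> \<le> R" for x R
  proof -
    have "cosh (\<beta> * x) = cosh (\<beta> * \<bar>x\<bar>)" by (auto simp: abs_if)
    also have "\<dots> \<le> cosh (\<beta> * R)" using that \<beta> by (subst cosh_real_nonneg_le_iff) auto
    finally show ?thesis .
  qed
  have half: "summable (\<lambda>n. (1/2::real)^n * c)" for c
    by (intro summable_mult2 summable_geometric) simp
  have sa: "summable (\<lambda>n. ?a n x)" for x
    by (rule summable_comparison_test[OF _ half[of "cosh (\<beta> * x)"]]) (use bnd(1) in auto)
  have sb: "summable (\<lambda>n. ?b n x)" for x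
    by (rule summable_comparison_test[OF _ half[of "\<beta> * sinh (\<beta> * \<bar>x\<bar>)"]])
      (use bnd(2) in \<open>auto simp: mult.assoc\<close>)
  have dg: "(g has_real_derivative g' x) (at x)" for x
  proof -
    define R where "R = \<bar>x\<bar> + 1"
    show ?thesis unfolding g_def g'_def
    proof (rule has_field_derivative_series'(2)[where S = "{-R..R}" and x0 = x])
      show "(?a n has_real_derivative ?b n y) (at y within {-R..R})" for n y
        using volterra_term_has_deriv has_field_derivative_at_within by blast
      show "uniformly_convergent_on {-R..R} (\<lambda>n y. \<Sum>i<n. ?b i y)"
      proof (rule Weierstrass_m_test'[OF _ half[of "\<beta> * sinh (\<beta> * R)"]])
        fix n y assume "y \<in> {-R..R}"
        then have "sinh (\<beta> * \<bar>y\<bar>) \<le> sinh (\<beta> * R)" using \<beta> by (subst sinh_real_le_iff) auto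
        then have "(1/2)^n * \<beta> * sinh (\<beta> * \<bar>y\<bar>) \<le> (1/2)^n * \<beta> * sinh (\<beta> * R)"
          using \<beta> by (intro mult_left_mono) auto
        then have "\<bar>?b n y\<bar> \<le> (1/2)^n * \<beta> * sinh (\<beta> * R)"
          using bnd(2)[of n y] by linarith
        then show "norm (?b n y) \<le> (1/2)^n * (\<beta> * sinh (\<beta> * R))"
          by (simp only: real_norm_def mult.assoc)
      qed
    qed (use sa in \<open>auto simp: R_def\<close>)
  qed
  have "(g' has_real_derivative V x * g x) (at x)" for x
  proof -
    define R where "R = \<bar>x\<bar> + 1"
    \<comment> \<open>The term of index 0 is zero; after the shift the summands have derivatives
      \<open>V * ?a n\<close>, which add up to \<open>V * g\<close>.\<close>
    have eq: "g' = (\<lambda>x. \<Sum>n. ?b (Suc n) x)"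
      unfolding g'_def using suminf_split_head[OF sb] by auto
    have "((\<lambda>x. \<Sum>n. ?b (Suc n) x) has_real_derivative (\<Sum>n. V x * ?a n x)) (at x)"
    proof (rule has_field_derivative_series'(2)[where S = "{-R..R}" and x0 = x])
      show "(?b (Suc n) has_real_derivative V y * ?a n y) (at y within {-R..R})" for n y
        using volterra_term_deriv_Suc has_field_derivative_at_within by blast
      show "uniformly_convergent_on {-R..R} (\<lambda>n y. \<Sum>i<n. V y * ?a i y)"
      proof (rule Weierstrass_m_test'[OF _ half[of "N * cosh (\<beta> * R)"]])
        fix n y assume "y \<in> {-R..R}"
        then have "(1/2)^n * cosh (\<beta> * y) \<le> (1/2)^n * cosh (\<beta> * R)"
          using cosh_mono[of y R] by (intro mult_left_mono) auto
        then have "\<bar>?a n y\<bar> \<le> (1/2)^n * cosh (\<beta> * R)"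
          using bnd(1)[of n y] by linarith
        then have "\<bar>V y\<bar> * \<bar>?a n y\<bar> \<le> N * ((1/2)^n * cosh (\<beta> * R))"
          using N[of y] \<open>N > 0\<close> by (intro mult_mono) auto
        then show "norm (V y * ?a n y) \<le> (1/2)^n * (N * cosh (\<beta> * R))"
          by (simp add: abs_mult mult_ac)
      qed
      show "summable (\<lambda>n. ?b (Suc n) x)"
        by (rule iffD2[OF summable_Suc_iff[of "\<lambda>n. ?b n x"] sb])
    qed (auto simp: R_def)
    then show ?thesis unfolding eq g_def by (simp add: suminf_mult[OF sa])
  qed
  moreover have "g 0 = 1"
  proof -
    have "?a n 0 = (if n = 0 then 1 else 0)" for n
      by (cases n) (auto simp: interval_integral_0_0)
    then have "(\<lambda>n. ?a n 0) = (\<lambda>n. if n = 0 then 1 else 0)" by blast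
    then show ?thesis
      unfolding g_def using sums_unique[OF sums_single[of 0 "\<lambda>n. 1::real"]] by simp
  qed
  moreover have "g' 0 = 0"
  proof -
    have "?b n 0 = 0" for n
      by (cases n) (auto simp: interval_integral_0_0)
    then show ?thesis unfolding g'_def by simp
  qed
  ultimately show thesis using that dg by blast
qed

end

text \<open>A Gronwall estimate for the energy w^2 + w'^2. The forcing term f allows two uses: f = 0
  yields uniqueness, and a small f compares solutions for two values of the spectral
  parameter.\<close>

lemma linear_ode_stability:
  fixes w w' V :: "real \<Rightarrow> real"
  assumes w: "\<And>x. (w has_real_derivative w' x) (at x)"
    and w': "\<And>x. (w' has_real_derivative V x * w x + f x) (at x)"
    and V: "\<And>x. \<bar>V x\<bar> \<le> M"
    and f: "\<And>x. x \<in> {0..h} \<Longrightarrow> \<bar>f x\<bar> \<le> \<epsilon>"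
    and 0: "w 0 = 0" "w' 0 = 0" and x: "x \<in> {0..h}"
  shows "(w x)\<^sup>2 + (w' x)\<^sup>2 \<le> \<epsilon>\<^sup>2 * h * exp ((M + 2) * h)"
proof -
  \<comment> \<open>The derivative of the energy is at most L times the energy plus \<epsilon>^2:
    the product 2 w w' contributes 1 to L, the potential M, and the forcing term another 1.\<close>
  define L where "L = M + 2"
  define N where "N = (\<lambda>x. ((w x)\<^sup>2 + (w' x)\<^sup>2) * exp (- (L * x)) - \<epsilon>\<^sup>2 * x)"
  have "0 \<le> M" using V[of 0] by linarith
  have "N x \<le> N 0"
  proof (rule DERIV_nonpos_imp_nonincreasing[where f = N])
    fix y assume y: "0 \<le> y" "y \<le> x"
    let ?d = "(2 * w y * w' y + 2 * w' y * (V y * w y + f y) - L * ((w y)\<^sup>2 + (w' y)\<^sup>2))"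
    have "(N has_real_derivative ?d * exp (- (L * y)) - \<epsilon>\<^sup>2) (at y)"
      unfolding N_def by (auto intro!: derivative_eq_intros w w' simp: algebra_simps power2_eq_square)
    moreover have "?d * exp (- (L * y)) - \<epsilon>\<^sup>2 \<le> 0"
    proof -
      have a: "2 * w y * w' y \<le> (w y)\<^sup>2 + (w' y)\<^sup>2" by (rule sum_squares_bound)
      have fe: "(f y)\<^sup>2 \<le> \<epsilon>\<^sup>2" using power_mono[of "\<bar>f y\<bar>" \<epsilon> 2] f[of y] y x by simp
      have "2 * w' y * (V y * w y) \<le> \<bar>V y\<bar> * (2 * \<bar>w y\<bar> * \<bar>w' y\<bar>)"
        using abs_ge_self[of "2 * w' y * (V y * w y)"] by (simp add: abs_mult mult_ac)
      also have "\<dots> \<le> M * ((w y)\<^sup>2 + (w' y)\<^sup>2)"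
        using sum_squares_bound[of "\<bar>w y\<bar>" "\<bar>w' y\<bar>"] \<open>0 \<le> M\<close>
        by (intro mult_mono V) auto
      finally have b: "2 * w' y * (V y * w y) \<le> M * ((w y)\<^sup>2 + (w' y)\<^sup>2)" .
      have "2 * w' y * f y \<le> (w' y)\<^sup>2 + (f y)\<^sup>2" by (rule sum_squares_bound)
      moreover have "L * ((w y)\<^sup>2 + (w' y)\<^sup>2) = M * ((w y)\<^sup>2 + (w' y)\<^sup>2) + 2 * (w y)\<^sup>2 + 2 * (w' y)\<^sup>2"
        by (simp add: L_def algebra_simps)
      moreover have "2 * w' y * (V y * w y + f y) = 2 * w' y * (V y * w y) + 2 * w' y * f y"
        by (simp add: algebra_simps)
      ultimately have "?d \<le> \<epsilon>\<^sup>2"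
        using a b fe zero_le_power2[of "w y"] by linarith
      then have "?d * exp (- (L * y)) \<le> \<epsilon>\<^sup>2 * exp (- (L * y))"
        by (intro mult_right_mono) auto
      also have "\<dots> \<le> \<epsilon>\<^sup>2 * 1"
        using \<open>0 \<le> M\<close> y by (intro mult_left_mono) (auto simp: L_def)
      finally show ?thesis by simp
    qed
    ultimately show "\<exists>d. (N has_real_derivative d) (at y) \<and> d \<le> 0" by blast
  qed (use x in auto)
  then have "((w x)\<^sup>2 + (w' x)\<^sup>2) * exp (- (L * x)) \<le> \<epsilon>\<^sup>2 * x"
    using 0 by (simp add: N_def)
  then have "((w x)\<^sup>2 + (w' x)\<^sup>2) * exp (- (L * x)) * exp (L * x) \<le> \<epsilon>\<^sup>2 * x * exp (L * x)"
    by (intro mult_right_mono) auto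
  then have "(w x)\<^sup>2 + (w' x)\<^sup>2 \<le> \<epsilon>\<^sup>2 * x * exp (L * x)"
    by (simp add: mult.assoc flip: exp_add)
  also have "\<dots> \<le> \<epsilon>\<^sup>2 * h * exp (L * h)"
    using x \<open>0 \<le> M\<close> by (intro mult_mono) (auto simp: L_def intro!: mult_left_mono)
  finally show ?thesis by (simp add: L_def)
qed

text \<open>Stability with zero forcing, started at c. To the left of c the equation is reflected,
  which replaces w' by -w' and keeps the second-order equation in the same form.\<close>

lemma linear_ode_unique:
  fixes w w' V :: "real \<Rightarrow> real"
  assumes w: "\<And>x. (w has_real_derivative w' x) (at x)"
    and w': "\<And>x. (w' has_real_derivative V x * w x) (at x)"
    and V: "\<And>x. \<bar>V x\<bar> \<le> M"
    and c: "w c = 0" "w' c = 0"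
  shows "w x = 0" "w' x = 0"
proof -
  have "(w x)\<^sup>2 + (w' x)\<^sup>2 \<le> 0"
  proof (cases "c \<le> x")
    case True
    have "(w (c + (x - c)))\<^sup>2 + (w' (c + (x - c)))\<^sup>2 \<le> 0\<^sup>2 * (x - c) * exp ((M + 2) * (x - c))"
    proof (rule linear_ode_stability[where w = "\<lambda>y. w (c + y)" and w' = "\<lambda>y. w' (c + y)"
          and V = "\<lambda>y. V (c + y)" and f = "\<lambda>y. 0"])
      fix y
      show "((\<lambda>y. w (c + y)) has_real_derivative w' (c + y)) (at y)"
        using w[of "c + y"] DERIV_at_within_shift[of w _ c y UNIV] by simp
      show "((\<lambda>y. w' (c + y)) has_real_derivative V (c + y) * w (c + y) + 0) (at y)"
        using w'[of "c + y"] DERIV_at_within_shift[of w' _ c y UNIV] by simp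
    qed (use V c True in auto)
    then show ?thesis by simp
  next
    case False
    have "(w (c - (c - x)))\<^sup>2 + (- w' (c - (c - x)))\<^sup>2 \<le> 0\<^sup>2 * (c - x) * exp ((M + 2) * (c - x))"
    proof (rule linear_ode_stability[where w = "\<lambda>y. w (c - y)" and w' = "\<lambda>y. - w' (c - y)"
          and V = "\<lambda>y. V (c - y)" and f = "\<lambda>y. 0"])
      fix y
      show "((\<lambda>y. w (c - y)) has_real_derivative - w' (c - y)) (at y)"
        by (rule has_real_derivative_reflect[OF w])
      show "((\<lambda>y. - w' (c - y)) has_real_derivative V (c - y) * w (c - y) + 0) (at y)"
        using DERIV_minus[OF has_real_derivative_reflect[OF w']] by simp
    qed (use V c False in auto)
    then show ?thesis by simp
  qed
  then show "w x = 0" "w' x = 0"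
    by (metis sum_power2_le_zero_iff)+
qed

text \<open>Shooting in the spectral parameter \<open>\<mu>\<close>, starting with \<open>g 0 = 1\<close>, \<open>g' 0 = 0\<close>. At \<open>\<mu> = 0\<close>
  the solution is \<open>cosh (\<omega> t)\<close>, so \<open>g' h > 0\<close>. At \<open>\<mu> = \<omega>\<^sup>2 / e\<close> a solution that is nonnegative on
  \<open>[0, h]\<close> is concave there, so \<open>g' h \<le> 0\<close>. If it is not nonnegative, then for some smaller \<open>\<mu>\<close>
  the minimum of \<open>g\<close> over \<open>[0, h]\<close> is \<open>0\<close>, and it is attained at \<open>h\<close> since \<open>g\<close> has only simple
  zeros; again \<open>g' h \<le> 0\<close>.\<close>

lemma neumann_eigenvalue_exists:
  fixes E :: "real \<Rightarrow> real"
  assumes E: "continuous_on UNIV E" and e: "0 < e" and lo: "\<And>t. e \<le> E t" and hi: "\<And>t. E t \<le> C"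
    and h: "0 < h" and \<omega>: "0 < \<omega>"
  obtains \<mu> g g' where "0 < \<mu>" "\<mu> \<le> \<omega>\<^sup>2 / e" "g 0 = 1" "g' 0 = 0" "g' h = 0"
    "\<And>t. (g has_real_derivative g' t) (at t)"
    "\<And>t. (g' has_real_derivative (\<omega>\<^sup>2 - \<mu> * E t) * g t) (at t)"
proof -
  let ?V = "\<lambda>\<mu> t. \<omega>\<^sup>2 - \<mu> * E t"
  have E_pos: "0 < E t" for t using lo[of t] e by linarith
  have "0 < C" using E_pos[of 0] hi[of 0] by linarith
  have V_bound: "\<bar>?V \<mu> t\<bar> \<le> \<omega>\<^sup>2 + \<bar>\<mu>\<bar> * C" for \<mu> t
  proof -
    have "\<bar>\<mu> * E t\<bar> \<le> \<bar>\<mu>\<bar> * C"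
      unfolding abs_mult using E_pos[of t] hi[of t] by (intro mult_left_mono) auto
    then show ?thesis using abs_triangle_ineq4[of "\<omega>\<^sup>2" "\<mu> * E t"] by simp
  qed
  \<comment> \<open>Solution and derivative form one pair, so that a single choice turns both into
    functions of \<mu>.\<close>
  have "\<exists>p. fst p 0 = 1 \<and> snd p 0 = 0 \<and> (\<forall>t. (fst p has_real_derivative snd p t) (at t)) \<and>
      (\<forall>t. (snd p has_real_derivative ?V \<mu> t * fst p t) (at t))" for \<mu>
  proof -
    have "continuous_on UNIV (?V \<mu>)" by (intro continuous_intros E)
    from linear_ode_exists[OF this V_bound] obtain g g' where
      "g 0 = 1" "g' 0 = 0" "\<And>x. (g has_real_derivative g' x) (at x)"
      "\<And>x. (g' has_real_derivative ?V \<mu> x * g x) (at x)" by metis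
    then show ?thesis by (intro exI[of _ "(g, g')"]) simp
  qed
  then obtain p where p: "\<And>\<mu>. fst (p \<mu>) 0 = 1 \<and> snd (p \<mu>) 0 = 0 \<and>
      (\<forall>t. (fst (p \<mu>) has_real_derivative snd (p \<mu>) t) (at t)) \<and>
      (\<forall>t. (snd (p \<mu>) has_real_derivative ?V \<mu> t * fst (p \<mu>) t) (at t))"
    by metis
  define g where "g = (\<lambda>\<mu>. fst (p \<mu>))"
  define g' where "g' = (\<lambda>\<mu>. snd (p \<mu>))"
  have g0: "g \<mu> 0 = 1" "g' \<mu> 0 = 0"
    and dg: "(g \<mu> has_real_derivative g' \<mu> t) (at t)"
    and dg': "(g' \<mu> has_real_derivative ?V \<mu> t * g \<mu> t) (at t)" for \<mu> t
    using p[of \<mu>] by (auto simp: g_def g'_def)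
  have contg: "continuous_on S (g \<mu>)" for S \<mu>
    using dg DERIV_isCont continuous_at_imp_continuous_on by blast
  \<comment> \<open>A zero with zero slope would make the solution vanish identically, against
    \<open>g \<mu> 0 = 1\<close>.\<close>
  have nontriv: "g' \<mu> t \<noteq> 0" if "g \<mu> t = 0" for \<mu> t
    using linear_ode_unique(1)[OF dg dg' V_bound that, of 0] g0 by auto

  \<comment> \<open>Local Lipschitz dependence on \<mu>, uniform on [0, h]. The difference of two
    solutions satisfies the equation for \<mu> with forcing
    \<open>(\<nu> - \<mu>) * E t * g \<nu> t\<close>; the restriction to distance 1 gives one bound
    M for all the potentials involved.\<close>
  have cont: "\<exists>K. \<forall>\<mu>. \<bar>\<mu> - \<nu>\<bar> \<le> 1 \<longrightarrow> (\<forall>t\<in>{0..h}.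
      \<bar>g \<mu> t - g \<nu> t\<bar> \<le> K * \<bar>\<mu> - \<nu>\<bar> \<and> \<bar>g' \<mu> t - g' \<nu> t\<bar> \<le> K * \<bar>\<mu> - \<nu>\<bar>)" for \<nu>
  proof -
    have "compact (g \<nu> ` {0..h})" by (intro compact_continuous_image contg) simp
    then obtain B where B: "\<And>t. t \<in> {0..h} \<Longrightarrow> \<bar>g \<nu> t\<bar> \<le> B"
      by (metis bounded_real compact_imp_bounded imageI)
    have "0 \<le> B" using B[of 0] h by auto
    define M where "M = \<omega>\<^sup>2 + (\<bar>\<nu>\<bar> + 1) * C"
    define K where "K = C * B * sqrt (h * exp ((M + 2) * h))"
    have "\<bar>g \<mu> t - g \<nu> t\<bar> \<le> K * \<bar>\<mu> - \<nu>\<bar> \<and> \<bar>g' \<mu> t - g' \<nu> t\<bar> \<le> K * \<bar>\<mu> - \<nu>\<bar>"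
      if \<mu>: "\<bar>\<mu> - \<nu>\<bar> \<le> 1" and t: "t \<in> {0..h}" for \<mu> t
    proof -
      have "(g \<mu> t - g \<nu> t)\<^sup>2 + (g' \<mu> t - g' \<nu> t)\<^sup>2
          \<le> (\<bar>\<mu> - \<nu>\<bar> * C * B)\<^sup>2 * h * exp ((M + 2) * h)"
      proof (rule linear_ode_stability[where w = "\<lambda>t. g \<mu> t - g \<nu> t"
            and w' = "\<lambda>t. g' \<mu> t - g' \<nu> t" and V = "?V \<mu>" and f = "\<lambda>t. (\<nu> - \<mu>) * E t * g \<nu> t"])
        fix s
        show "((\<lambda>t. g \<mu> t - g \<nu> t) has_real_derivative g' \<mu> s - g' \<nu> s) (at s)"
          by (intro derivative_intros dg)
        have "((\<lambda>t. g' \<mu> t - g' \<nu> t) has_real_derivative ?V \<mu> s * g \<mu> s - ?V \<nu> s * g \<nu> s) (at s)"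
          by (intro derivative_intros dg')
        also have "?V \<mu> s * g \<mu> s - ?V \<nu> s * g \<nu> s
            = ?V \<mu> s * (g \<mu> s - g \<nu> s) + (\<nu> - \<mu>) * E s * g \<nu> s" by (simp add: algebra_simps)
        finally show "((\<lambda>t. g' \<mu> t - g' \<nu> t) has_real_derivative
            ?V \<mu> s * (g \<mu> s - g \<nu> s) + (\<nu> - \<mu>) * E s * g \<nu> s) (at s)" .
        have "\<bar>\<mu>\<bar> * C \<le> (\<bar>\<nu>\<bar> + 1) * C" using \<mu> \<open>0 < C\<close> by (intro mult_right_mono) auto
        then show "\<bar>?V \<mu> s\<bar> \<le> M" using V_bound[of \<mu> s] by (simp add: M_def)
        assume s: "s \<in> {0..h}"
        have "\<bar>\<mu> - \<nu>\<bar> * E s * \<bar>g \<nu> s\<bar> \<le> \<bar>\<mu> - \<nu>\<bar> * C * B"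
          using hi[of s] E_pos[of s] B[OF s] \<open>0 < C\<close> by (intro mult_mono) auto
        then show "\<bar>(\<nu> - \<mu>) * E s * g \<nu> s\<bar> \<le> \<bar>\<mu> - \<nu>\<bar> * C * B"
          using E_pos[of s] by (simp add: abs_mult abs_minus_commute)
      qed (use g0 t in auto)
      also have "\<dots> = (K * \<bar>\<mu> - \<nu>\<bar>)\<^sup>2"
        using h by (simp add: K_def power_mult_distrib)
      finally have le: "(g \<mu> t - g \<nu> t)\<^sup>2 + (g' \<mu> t - g' \<nu> t)\<^sup>2 \<le> (K * \<bar>\<mu> - \<nu>\<bar>)\<^sup>2" .
      have "0 \<le> K * \<bar>\<mu> - \<nu>\<bar>" using \<open>0 < C\<close> \<open>0 \<le> B\<close> h by (simp add: K_def)
      have "(g \<mu> t - g \<nu> t)\<^sup>2 \<le> (K * \<bar>\<mu> - \<nu>\<bar>)\<^sup>2" "(g' \<mu> t - g' \<nu> t)\<^sup>2 \<le> (K * \<bar>\<mu> - \<nu>\<bar>)\<^sup>2"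
        using le zero_le_power2[of "g \<mu> t - g \<nu> t"] zero_le_power2[of "g' \<mu> t - g' \<nu> t"]
        by linarith+
      then show ?thesis using \<open>0 \<le> K * \<bar>\<mu> - \<nu>\<bar>\<close> abs_le_square_iff by (metis abs_of_nonneg)
    qed
    then show ?thesis by blast
  qed
  have Lipschitz_isCont: "isCont F \<nu>"
    if "\<And>\<mu>. \<bar>\<mu> - \<nu>\<bar> \<le> 1 \<Longrightarrow> \<bar>F \<mu> - F \<nu>\<bar> \<le> K * \<bar>\<mu> - \<nu>\<bar>" for F :: "real \<Rightarrow> real" and \<nu> K
  proof -
    have "((\<lambda>\<mu>. K * \<bar>\<mu> - \<nu>\<bar>) \<longlongrightarrow> 0) (at \<nu>)" by (auto intro!: tendsto_eq_intros)
    moreover have "eventually (\<lambda>\<mu>. norm (F \<mu> - F \<nu>) \<le> K * \<bar>\<mu> - \<nu>\<bar>) (at \<nu>)"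
      unfolding eventually_at using that by (intro exI[of _ 1]) (auto simp: dist_real_def)
    ultimately have "((\<lambda>\<mu>. F \<mu> - F \<nu>) \<longlongrightarrow> 0) (at \<nu>)" by (rule Lim_null_comparison[rotated])
    then show ?thesis unfolding isCont_def by (rule LIM_zero_cancel)
  qed

  define m where "m = (\<lambda>\<mu>. INF t\<in>{0..h}. g \<mu> t)"
  have m_attained: "\<exists>t\<in>{0..h}. g \<mu> t = m \<mu>" for \<mu>
  proof -
    obtain t where "t \<in> {0..h}" "\<forall>s\<in>{0..h}. g \<mu> t \<le> g \<mu> s"
      using continuous_attains_inf[of "{0..h}" "g \<mu>"] contg h by auto
    moreover have "m \<mu> = g \<mu> t"
      unfolding m_def using calculation by (intro cInf_eq_minimum) auto
    ultimately show ?thesis by auto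
  qed
  have m_le: "m \<mu> \<le> g \<mu> t" if "t \<in> {0..h}" for \<mu> t
  proof -
    have "bdd_below (g \<mu> ` {0..h})"
      by (intro bounded_imp_bdd_below compact_imp_bounded compact_continuous_image contg) simp
    then show ?thesis unfolding m_def using that by (rule cINF_lower)
  qed
  \<comment> \<open>Minima of two functions at uniform distance \<delta> differ by at most \<delta>:
    a minimum point of either function tests the other.\<close>
  have m_cont: "isCont m \<nu>" for \<nu>
  proof -
    obtain K where K: "\<And>\<mu> t. \<bar>\<mu> - \<nu>\<bar> \<le> 1 \<Longrightarrow> t \<in> {0..h} \<Longrightarrow> \<bar>g \<mu> t - g \<nu> t\<bar> \<le> K * \<bar>\<mu> - \<nu>\<bar>"
      using cont[of \<nu>] by blast
    show ?thesis
    proof (rule Lipschitz_isCont)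
      fix \<mu> assume \<mu>: "\<bar>\<mu> - \<nu>\<bar> \<le> 1"
      obtain s t where "s \<in> {0..h}" "g \<mu> s = m \<mu>" "t \<in> {0..h}" "g \<nu> t = m \<nu>"
        using m_attained by meson
      then show "\<bar>m \<mu> - m \<nu>\<bar> \<le> K * \<bar>\<mu> - \<nu>\<bar>"
        using K[OF \<mu>, of s] K[OF \<mu>, of t] m_le[of s \<nu>] m_le[of t \<mu>] by (auto simp: abs_le_iff)
    qed
  qed
  have D_cont: "isCont (\<lambda>\<mu>. g' \<mu> h) \<nu>" for \<nu>
  proof -
    obtain K where "\<And>\<mu>. \<bar>\<mu> - \<nu>\<bar> \<le> 1 \<Longrightarrow> \<bar>g' \<mu> h - g' \<nu> h\<bar> \<le> K * \<bar>\<mu> - \<nu>\<bar>"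
      using cont[of \<nu>] h by (meson atLeastAtMost_iff order_refl less_imp_le)
    then show ?thesis by (rule Lipschitz_isCont)
  qed

  have at0: "g 0 t = cosh (\<omega> * t)" "g' 0 t = \<omega> * sinh (\<omega> * t)" for t
  proof -
    have d: "((\<lambda>t. g 0 t - cosh (\<omega> * t)) has_real_derivative g' 0 s - \<omega> * sinh (\<omega> * s)) (at s)"
      for s
      by (auto intro!: derivative_eq_intros dg)
    have d': "((\<lambda>t. g' 0 t - \<omega> * sinh (\<omega> * t)) has_real_derivative
        ?V 0 s * (g 0 s - cosh (\<omega> * s))) (at s)" for s
      by (auto intro!: derivative_eq_intros dg' simp: algebra_simps power2_eq_square)
    show "g 0 t = cosh (\<omega> * t)" "g' 0 t = \<omega> * sinh (\<omega> * t)"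
      using linear_ode_unique[OF d d' V_bound, of 0 t] g0 by auto
  qed
  have D0: "g' 0 h > 0" using h \<omega> by (simp add: at0)
  have m0: "m 0 > 0" using m_attained[of 0] at0 by (metis cosh_real_pos)

  define \<mu>1 where "\<mu>1 = \<omega>\<^sup>2 / e"
  have "\<mu>1 > 0" using \<omega> e by (simp add: \<mu>1_def)
  have "\<exists>\<mu>. 0 \<le> \<mu> \<and> \<mu> \<le> \<mu>1 \<and> g' \<mu> h \<le> 0"
  proof (cases "m \<mu>1 \<ge> 0")
    case True
    have "g' \<mu>1 h \<le> g' \<mu>1 0"
    proof (rule DERIV_nonpos_imp_nonincreasing[where f = "g' \<mu>1"])
      fix t assume "0 \<le> t" "t \<le> h"
      then have "0 \<le> g \<mu>1 t" using m_le[of t \<mu>1] True by simp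
      moreover have "?V \<mu>1 t \<le> 0"
        using mult_left_mono[OF lo[of t], of \<mu>1] \<open>\<mu>1 > 0\<close> e by (simp add: \<mu>1_def)
      ultimately show "\<exists>y. (g' \<mu>1 has_real_derivative y) (at t) \<and> y \<le> 0"
        using dg' mult_nonpos_nonneg by blast
    qed (use h in auto)
    then show ?thesis using g0 \<open>\<mu>1 > 0\<close> by (intro exI[of _ \<mu>1]) auto
  next
    case False
    then obtain \<mu> where \<mu>: "0 \<le> \<mu>" "\<mu> \<le> \<mu>1" "m \<mu> = 0"
      using IVT2[of m \<mu>1 0 0] m_cont m0 \<open>\<mu>1 > 0\<close> by auto
    obtain t where t: "t \<in> {0..h}" "g \<mu> t = 0" using m_attained[of \<mu>] \<mu> by auto
    have nonneg: "0 \<le> g \<mu> s" if "s \<in> {0..h}" for s using m_le[OF that, of \<mu>] \<mu> by simp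
    have "t \<noteq> 0" using t g0 by auto
    have "g' \<mu> t \<le> 0"
    proof (rule ccontr)
      assume "\<not> g' \<mu> t \<le> 0"
      then obtain d where d: "d > 0" "\<And>k. 0 < k \<Longrightarrow> k < d \<Longrightarrow> g \<mu> (t - k) < g \<mu> t"
        using DERIV_pos_inc_left[OF dg, of \<mu> t] by auto
      define k where "k = min (d / 2) t"
      have "0 < k" "k < d" "t - k \<in> {0..h}" using d(1) t(1) \<open>t \<noteq> 0\<close> by (auto simp: k_def)
      then show False using d(2)[of k] nonneg[of "t - k"] t(2) by auto
    qed
    \<comment> \<open>The slope at the zero t is not positive, and it is not zero because zeros are
      simple. A negative slope with room to the right of t would make g negative there, so t is the
      right endpoint.\<close>
    moreover have "\<not> (g' \<mu> t < 0 \<and> t < h)"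
    proof
      assume a: "g' \<mu> t < 0 \<and> t < h"
      then obtain d where d: "d > 0" "\<And>k. 0 < k \<Longrightarrow> k < d \<Longrightarrow> g \<mu> (t + k) < g \<mu> t"
        using DERIV_neg_dec_right[OF dg, of \<mu> t] by auto
      define k where "k = min (d / 2) (h - t)"
      have "0 < k" "k < d" "t + k \<in> {0..h}" using d(1) t(1) a by (auto simp: k_def)
      then show False using d(2)[of k] nonneg[of "t + k"] t(2) by auto
    qed
    ultimately have "t = h" using nontriv[OF t(2)] t(1) by auto
    then show ?thesis using \<mu> \<open>g' \<mu> t \<le> 0\<close> by auto
  qed
  then obtain \<mu>2 where \<mu>2: "0 \<le> \<mu>2" "\<mu>2 \<le> \<mu>1" "g' \<mu>2 h \<le> 0" by auto
  \<comment> \<open>The slope at h is positive for parameter 0 and nonpositive for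
    \<open>\<mu>2\<close>. The parameter found in between is therefore different from 0, which makes
    the eigenvalue positive.\<close>
  then obtain \<mu> where \<mu>: "0 \<le> \<mu>" "\<mu> \<le> \<mu>2" "g' \<mu> h = 0"
    using IVT2[of "\<lambda>\<mu>. g' \<mu> h" \<mu>2 0 0] D_cont D0 by auto
  have "\<mu> \<noteq> 0" using \<mu> D0 by auto
  then have "0 < \<mu>" "\<mu> \<le> \<omega>\<^sup>2 / e" using \<mu> \<mu>2 by (simp_all add: \<mu>1_def)
  then show thesis by (rule that[OF _ _ g0 \<mu>(3) dg dg'])
qed

text \<open>Zero slope at 0 and at h makes g symmetric about both points, since E is; the
  composition of the two reflections is the translation by 2h.\<close>

lemma periodic_hill_solution_exists:
  fixes E :: "real \<Rightarrow> real"
  assumes E: "continuous_on UNIV E" and e: "0 < e" and lo: "\<And>t. e \<le> E t" and hi: "\<And>t. E t \<le> C"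
    and h: "0 < h" and \<omega>: "0 < \<omega>"
    and even: "\<And>t. E (- t) = E t" and sym: "\<And>t. E (2 * h - t) = E t"
  obtains \<mu> g g' where "0 < \<mu>" "\<mu> \<le> \<omega>\<^sup>2 / e" "g 0 = 1" "\<And>t. g (t + 2 * h) = g t"
    "\<And>t. (g has_real_derivative g' t) (at t)"
    "\<And>t. (g' has_real_derivative (\<omega>\<^sup>2 - \<mu> * E t) * g t) (at t)"
proof -
  obtain \<mu> g g' where \<mu>: "0 < \<mu>" "\<mu> \<le> \<omega>\<^sup>2 / e" and g0: "g 0 = 1" and g'0: "g' 0 = 0" "g' h = 0"
    and dg: "\<And>t. (g has_real_derivative g' t) (at t)"
    and dg': "\<And>t. (g' has_real_derivative (\<omega>\<^sup>2 - \<mu> * E t) * g t) (at t)"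
    using neumann_eigenvalue_exists[OF E e lo hi h \<omega>] by metis
  have V_bound: "\<bar>\<omega>\<^sup>2 - \<mu> * E t\<bar> \<le> \<omega>\<^sup>2 + \<mu> * C" for t
  proof -
    have "0 \<le> E t" using lo[of t] e by linarith
    then have "0 \<le> \<mu> * E t" "\<mu> * E t \<le> \<mu> * C" using \<mu> hi[of t] by (auto intro: mult_left_mono)
    then show ?thesis by (smt (verit) zero_le_power2)
  qed
  \<comment> \<open>The centre of the reflection is c/2. There \<open>g (c - t) - g t\<close> has
    value and slope 0, and it satisfies the same equation as g.\<close>
  have reflect: "g (c - t) = g t"
    if c: "\<And>t. E (c - t) = E t" "g' (c / 2) = 0" for c t
  proof -
    have d: "((\<lambda>t. g (c - t) - g t) has_real_derivative - g' (c - s) - g' s) (at s)" for s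
      by (intro derivative_intros has_real_derivative_reflect dg)
    have "((\<lambda>t. - g' (c - t) - g' t) has_real_derivative
        - (- ((\<omega>\<^sup>2 - \<mu> * E (c - s)) * g (c - s))) - (\<omega>\<^sup>2 - \<mu> * E s) * g s) (at s)" for s
      by (intro derivative_intros has_real_derivative_reflect dg')
    then have d': "((\<lambda>t. - g' (c - t) - g' t) has_real_derivative
        (\<omega>\<^sup>2 - \<mu> * E s) * (g (c - s) - g s)) (at s)" for s
      using c(1) by (simp add: right_diff_distrib)
    have "c - c / 2 = c / 2" by simp
    then show ?thesis
      using linear_ode_unique(1)[OF d d' V_bound, of "c / 2" t] c(2) by simp
  qed
  have "g (t + 2 * h) = g t" for t
    using reflect[of 0 t] reflect[of "2 * h" "- t"] even sym g'0 by (simp add: add.commute)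
  then show thesis using that \<mu> g0 dg dg' by metis
qed

section \<open>Jacobi elliptic functions\<close>

context
  fixes k :: real
  assumes k: "k\<^sup>2 < 1"
begin

lemma elliptic_radicand_pos: "0 < 1 - k\<^sup>2 * (sin x)\<^sup>2"
proof -
  have "k\<^sup>2 * (sin x)\<^sup>2 \<le> k\<^sup>2 * 1"
    by (intro mult_left_mono) (auto simp: abs_square_le_1)
  then show ?thesis using k by simp
qed

lemma elliptic_F_has_deriv:
  "(elliptic_F k has_real_derivative 1 / sqrt (1 - k\<^sup>2 * (sin x)\<^sup>2)) (at x)"
proof -
  have "continuous_on UNIV (\<lambda>x. 1 / sqrt (1 - k\<^sup>2 * (sin x)\<^sup>2))"
    using elliptic_radicand_pos by (auto intro!: continuous_intros simp: less_imp_neq[symmetric])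
  from has_real_derivative_interval_integral[OF this] show ?thesis
    unfolding elliptic_F_def[abs_def] .
qed

lemma elliptic_F_0: "elliptic_F k 0 = 0"
  unfolding elliptic_F_def by (rule interval_integral_0_0)

lemma elliptic_F_deriv_ge_1: "1 \<le> 1 / sqrt (1 - k\<^sup>2 * (sin x)\<^sup>2)"
  using elliptic_radicand_pos[of x] by (simp add: real_sqrt_le_1_iff)

text \<open>The integrand is at least 1, so F grows at least as fast as the identity. Injectivity,
  surjectivity and \<open>0 < elliptic_K k\<close> all rest on this.\<close>

lemma elliptic_F_diff_ge: "x \<le> y \<Longrightarrow> y - x \<le> elliptic_F k y - elliptic_F k x"
proof -
  assume xy: "x \<le> y"
  have "elliptic_F k x - x \<le> elliptic_F k y - y"
  proof (rule DERIV_nonneg_imp_nondecreasing[OF xy, where f = "\<lambda>x. elliptic_F k x - x"])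
    fix z
    have "((\<lambda>x. elliptic_F k x - x) has_real_derivative 1 / sqrt (1 - k\<^sup>2 * (sin z)\<^sup>2) - 1) (at z)"
      by (intro derivative_intros elliptic_F_has_deriv)
    then show "\<exists>d. ((\<lambda>x. elliptic_F k x - x) has_real_derivative d) (at z) \<and> 0 \<le> d"
      using elliptic_F_deriv_ge_1[of z] by (meson diff_ge_0_iff_ge)
  qed
  then show ?thesis by simp
qed

lemma bij_elliptic_F: "bij (elliptic_F k)"
proof (rule bijI)
  show "inj (elliptic_F k)"
  proof (rule linorder_injI)
    fix x y :: real
    assume "x < y"
    then show "elliptic_F k x \<noteq> elliptic_F k y" using elliptic_F_diff_ge[of x y] by linarith
  qed
  have "\<exists>x. elliptic_F k x = y" for y
  proof -
    have "\<exists>x\<ge>- \<bar>y\<bar>. x \<le> \<bar>y\<bar> \<and> elliptic_F k x = y"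
    proof (rule IVT)
      show "elliptic_F k (- \<bar>y\<bar>) \<le> y" "y \<le> elliptic_F k \<bar>y\<bar>"
        using elliptic_F_diff_ge[of "- \<bar>y\<bar>" 0] elliptic_F_diff_ge[of 0 "\<bar>y\<bar>"] elliptic_F_0 by auto
      show "- \<bar>y\<bar> \<le> \<bar>y\<bar>" by simp
      show "\<forall>x. - \<bar>y\<bar> \<le> x \<and> x \<le> \<bar>y\<bar> \<longrightarrow> isCont (elliptic_F k) x"
        using DERIV_isCont[OF elliptic_F_has_deriv] by simp
    qed
    then show ?thesis by blast
  qed
  then show "surj (elliptic_F k)" by (metis surjI)
qed

lemma am_F: "jacobi_am k (elliptic_F k x) = x"
  unfolding jacobi_am_def using bij_elliptic_F by (simp add: bij_is_inj)

lemma F_am: "elliptic_F k (jacobi_am k x) = x"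
  unfolding jacobi_am_def using bij_elliptic_F by (simp add: bij_is_surj surj_f_inv_f)

lemma elliptic_F_minus: "elliptic_F k (- x) = - elliptic_F k x"
proof -
  have "((\<lambda>x. elliptic_F k (0 - x) + elliptic_F k x) has_real_derivative
      - (1 / sqrt (1 - k\<^sup>2 * (sin (0 - x))\<^sup>2)) + 1 / sqrt (1 - k\<^sup>2 * (sin x)\<^sup>2)) (at x)" for x
    by (rule DERIV_add[OF has_real_derivative_reflect[OF elliptic_F_has_deriv] elliptic_F_has_deriv])
  then have "((\<lambda>x. elliptic_F k (0 - x) + elliptic_F k x) has_real_derivative 0) (at x)" for x
    by simp
  then have "elliptic_F k (0 - x) + elliptic_F k x = elliptic_F k (0 - 0) + elliptic_F k 0"
    by (intro DERIV_isconst_all) blast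
  then show ?thesis by (simp add: elliptic_F_0)
qed

text \<open>The integrand has period \<pi>, so the increment over a period is constant; at -\<pi>/2
  oddness evaluates it to 2K(k).\<close>

lemma elliptic_F_add_pi: "elliptic_F k (x + pi) = elliptic_F k x + 2 * elliptic_K k"
proof -
  have "((\<lambda>x. elliptic_F k (x + pi)) has_real_derivative 1 / sqrt (1 - k\<^sup>2 * (sin (x + pi))\<^sup>2)) (at x)"
    for x
    by (simp only: elliptic_F_has_deriv flip: DERIV_shift)
  then have "((\<lambda>x. elliptic_F k (x + pi) - elliptic_F k x) has_real_derivative
      1 / sqrt (1 - k\<^sup>2 * (sin (x + pi))\<^sup>2) - 1 / sqrt (1 - k\<^sup>2 * (sin x)\<^sup>2)) (at x)" for x
    by (rule DERIV_diff[OF _ elliptic_F_has_deriv])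
  then have "((\<lambda>x. elliptic_F k (x + pi) - elliptic_F k x) has_real_derivative 0) (at x)" for x
    by simp
  then have "elliptic_F k (x + pi) - elliptic_F k x
      = elliptic_F k (- (pi / 2) + pi) - elliptic_F k (- (pi / 2))"
    by (intro DERIV_isconst_all) blast
  then show ?thesis by (simp add: elliptic_F_minus elliptic_K_def)
qed

lemma elliptic_F_add_int_pi:
  "elliptic_F k (x + of_int j * pi) = elliptic_F k x + 2 * of_int j * elliptic_K k"
proof (induction j rule: int_induct[where k = 0])
  case (step1 i)
  then show ?case using elliptic_F_add_pi[of "x + of_int i * pi"] by (simp add: algebra_simps)
next
  case (step2 i)
  then show ?case using elliptic_F_add_pi[of "x + of_int (i - 1) * pi"] by (simp add: algebra_simps)
qed simp

lemma elliptic_K_pos: "0 < elliptic_K k"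
  unfolding elliptic_K_def using elliptic_F_diff_ge[of 0 "pi / 2"] elliptic_F_0 pi_gt_zero by linarith

section \<open>Symmetries and derivatives of the Jacobi functions\<close>

lemma am_0: "jacobi_am k 0 = 0"
  using am_F[of 0] by (simp add: elliptic_F_0)

lemma am_minus: "jacobi_am k (- x) = - jacobi_am k x"
  using am_F[of "- jacobi_am k x"] by (simp add: elliptic_F_minus F_am)

lemma am_add: "jacobi_am k (x + 2 * of_int j * elliptic_K k) = jacobi_am k x + of_int j * pi"
  using am_F[of "jacobi_am k x + of_int j * pi"] by (simp add: elliptic_F_add_int_pi F_am)

lemma sn_minus: "jacobi_sn k (- x) = - jacobi_sn k x"
  by (simp add: jacobi_sn_def am_minus)

text \<open>A shift by 2jK(k) adds j \<pi> to the amplitude. The sign (-1)^j is kept as a cosine,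
  the form in which the addition theorems produce it.\<close>

lemma
  assumes "\<sigma> = cos (of_int j * pi)"
  shows sn_add: "jacobi_sn k (x + 2 * of_int j * elliptic_K k) = \<sigma> * jacobi_sn k x"
    and cn_add: "jacobi_cn k (x + 2 * of_int j * elliptic_K k) = \<sigma> * jacobi_cn k x"
proof -
  have "sin (of_int j * pi) = 0" by (metis sin_zero_iff_int2)
  then show "jacobi_sn k (x + 2 * of_int j * elliptic_K k) = \<sigma> * jacobi_sn k x"
    and "jacobi_cn k (x + 2 * of_int j * elliptic_K k) = \<sigma> * jacobi_cn k x"
    by (simp_all add: assms jacobi_sn_def jacobi_cn_def am_add sin_add cos_add)
qed

lemma dn_pos: "0 < jacobi_dn k x"
  using elliptic_radicand_pos by (simp add: jacobi_dn_def jacobi_sn_def)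

lemma sn_cn_squared: "(jacobi_sn k x)\<^sup>2 + (jacobi_cn k x)\<^sup>2 = 1"
  by (simp add: jacobi_sn_def jacobi_cn_def)

lemma dn_squared: "(jacobi_dn k x)\<^sup>2 = 1 - k\<^sup>2 * (jacobi_sn k x)\<^sup>2"
  using elliptic_radicand_pos by (simp add: jacobi_dn_def jacobi_sn_def less_imp_le)

lemma am_has_deriv: "(jacobi_am k has_real_derivative jacobi_dn k x) (at x)"
proof -
  have "isCont (jacobi_am k) (elliptic_F k (jacobi_am k x))"
    by (rule isCont_inverse_function[of 1]) (simp_all add: am_F DERIV_isCont[OF elliptic_F_has_deriv])
  then have "(jacobi_am k has_real_derivative
      inverse (1 / sqrt (1 - k\<^sup>2 * (sin (jacobi_am k x))\<^sup>2))) (at x)"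
    using elliptic_radicand_pos[of "jacobi_am k x"]
    by (intro DERIV_inverse_function[OF elliptic_F_has_deriv, where a = "x - 1" and b = "x + 1"])
      (auto simp: F_am)
  then show ?thesis by (simp add: jacobi_dn_def jacobi_sn_def)
qed

lemma sn_has_deriv: "(jacobi_sn k has_real_derivative jacobi_cn k x * jacobi_dn k x) (at x)"
  unfolding jacobi_sn_def[abs_def] jacobi_cn_def
  by (auto intro!: derivative_eq_intros am_has_deriv)

lemma cn_has_deriv: "(jacobi_cn k has_real_derivative - jacobi_sn k x * jacobi_dn k x) (at x)"
  unfolding jacobi_sn_def jacobi_cn_def[abs_def]
  by (auto intro!: derivative_eq_intros am_has_deriv)

lemma dn_has_deriv:
  "(jacobi_dn k has_real_derivative - k\<^sup>2 * jacobi_sn k x * jacobi_cn k x) (at x)"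
proof -
  have pos: "0 < 1 - k\<^sup>2 * (jacobi_sn k x)\<^sup>2"
    using elliptic_radicand_pos by (simp add: jacobi_sn_def)
  have "(jacobi_dn k has_real_derivative
      - k\<^sup>2 * (2 * (jacobi_cn k x * jacobi_dn k x) * jacobi_sn k x)
        * (inverse (sqrt (1 - k\<^sup>2 * (jacobi_sn k x)\<^sup>2)) / 2)) (at x)"
    unfolding jacobi_dn_def[of k, abs_def]
    using pos by (auto intro!: derivative_eq_intros sn_has_deriv[unfolded jacobi_dn_def]
        simp: less_imp_neq[symmetric])
  also have "- k\<^sup>2 * (2 * (jacobi_cn k x * jacobi_dn k x) * jacobi_sn k x)
        * (inverse (sqrt (1 - k\<^sup>2 * (jacobi_sn k x)\<^sup>2)) / 2) = - k\<^sup>2 * jacobi_sn k x * jacobi_cn k x"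
    using dn_pos[of x] by (simp add: jacobi_dn_def[symmetric] field_simps)
  finally show ?thesis .
qed

end

section \<open>Smooth functions of two variables\<close>

text \<open>The real algebra with constants generated by B. It is the device for smoothness: if the
  partial derivatives of the generators lie in the algebra, no derivative of any order leaves
  it.\<close>

inductive_set function_algebra :: "('a \<Rightarrow> real) set \<Rightarrow> ('a \<Rightarrow> real) set" for B where
  base: "b \<in> B \<Longrightarrow> b \<in> function_algebra B"
| const: "(\<lambda>x. c) \<in> function_algebra B"
| add: "f \<in> function_algebra B \<Longrightarrow> g \<in> function_algebra B \<Longrightarrow> (\<lambda>x. f x + g x) \<in> function_algebra B"
| mult: "f \<in> function_algebra B \<Longrightarrow> g \<in> function_algebra B \<Longrightarrow> (\<lambda>x. f x * g x) \<in> function_algebra B"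

lemma partial_s_eqI:
  assumes "\<And>s t. ((\<lambda>x. f (x, t)) has_vector_derivative f' (s, t)) (at s)"
  shows "partial_s f = f'"
  using assms by (auto simp: partial_s_def vector_derivative_at)

lemma partial_t_eqI:
  assumes "\<And>s t. ((\<lambda>y. f (s, y)) has_vector_derivative f' (s, t)) (at t)"
  shows "partial_t f = f'"
  using assms by (auto simp: partial_t_def vector_derivative_at)

text \<open>The partial derivatives are total operators defined by choice; differentiability in the
  plane, restricted to coordinate lines, certifies their values and so opens the way to the sum and
  product rules.\<close>

lemma has_partial_derivatives:
  fixes f :: "real \<times> real \<Rightarrow> real"
  assumes "f differentiable_on UNIV"
  shows "((\<lambda>x. f (x, t)) has_real_derivative partial_s f (s, t)) (at s)"
    and "((\<lambda>y. f (s, y)) has_real_derivative partial_t f (s, t)) (at t)"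
proof -
  have f: "f differentiable (at x)" for x using assms unfolding differentiable_on_def by blast
  have "(\<lambda>x. (x, t)) differentiable (at s)" "(\<lambda>y. (s, y)) differentiable (at t)"
    unfolding differentiable_def by (auto intro!: derivative_eq_intros)
  then have "(f \<circ> (\<lambda>x. (x, t))) differentiable (at s)" "(f \<circ> (\<lambda>y. (s, y))) differentiable (at t)"
    by (auto intro: differentiable_chain_at f)
  then show "((\<lambda>x. f (x, t)) has_real_derivative partial_s f (s, t)) (at s)"
    and "((\<lambda>y. f (s, y)) has_real_derivative partial_t f (s, t)) (at t)"
    by (simp_all add: o_def vector_derivative_works partial_s_def partial_t_def
        has_real_derivative_iff_has_vector_derivative)
qed

text \<open>The sum and product rules extend closure under both partial derivatives from the
  generators to the whole algebra; induction on the order then treats all its elements at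
  once.\<close>

lemma smooth_function_algebra:
  fixes B :: "(real \<times> real \<Rightarrow> real) set"
  assumes B: "\<And>b. b \<in> B \<Longrightarrow> b differentiable_on UNIV \<and>
      partial_s b \<in> function_algebra B \<and> partial_t b \<in> function_algebra B"
    and f: "f \<in> function_algebra B"
  shows "smooth f"
proof -
  have closed: "f differentiable_on UNIV \<and>
      partial_s f \<in> function_algebra B \<and> partial_t f \<in> function_algebra B"
    if "f \<in> function_algebra B" for f
    using that
  proof induction
    case (base b)
    then show ?case by (rule B)
  next
    case (const c)
    have "partial_s (\<lambda>x. c) = (\<lambda>x. 0)" by (rule partial_s_eqI) (rule derivative_intros)
    moreover have "partial_t (\<lambda>x. c) = (\<lambda>x. 0)" by (rule partial_t_eqI) (rule derivative_intros)
    ultimately show ?case by (simp add: function_algebra.const)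
  next
    case (add f g)
    then have d: "f differentiable_on UNIV" "g differentiable_on UNIV" by auto
    note df = has_partial_derivatives[OF d(1)] and dg = has_partial_derivatives[OF d(2)]
    have "partial_s (\<lambda>x. f x + g x) = (\<lambda>x. partial_s f x + partial_s g x)"
      using DERIV_add[OF df(1) dg(1)]
      by (intro partial_s_eqI) (simp flip: has_real_derivative_iff_has_vector_derivative)
    moreover have "partial_t (\<lambda>x. f x + g x) = (\<lambda>x. partial_t f x + partial_t g x)"
      using DERIV_add[OF df(2) dg(2)]
      by (intro partial_t_eqI) (simp flip: has_real_derivative_iff_has_vector_derivative)
    ultimately show ?case
      using d add by (auto intro: function_algebra.add differentiable_on_add)
  next
    case (mult f g)
    then have d: "f differentiable_on UNIV" "g differentiable_on UNIV" by auto
    note df = has_partial_derivatives[OF d(1)] and dg = has_partial_derivatives[OF d(2)]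
    have "partial_s (\<lambda>x. f x * g x) = (\<lambda>x. f x * partial_s g x + partial_s f x * g x)"
      using DERIV_mult'[OF df(1) dg(1)]
      by (intro partial_s_eqI) (simp flip: has_real_derivative_iff_has_vector_derivative)
    moreover have "partial_t (\<lambda>x. f x * g x) = (\<lambda>x. f x * partial_t g x + partial_t f x * g x)"
      using DERIV_mult'[OF df(2) dg(2)]
      by (intro partial_t_eqI) (simp flip: has_real_derivative_iff_has_vector_derivative)
    ultimately show ?case
      using d mult by (auto intro: function_algebra.add function_algebra.mult differentiable_on_mult)
  qed
  have "C_times n f" if "f \<in> function_algebra B" for n f
    using that
    by (induction n arbitrary: f) (use closed differentiable_imp_continuous_on in auto)
  then show ?thesis using f by (simp add: smooth_def)
qed

section \<open>Functions of one coordinate and separated products\<close>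

lemma
  assumes "\<And>s. (\<phi> has_real_derivative \<phi>' s) (at s)"
  shows differentiable_comp_fst: "(\<lambda>x::real \<times> real. \<phi> (fst x)) differentiable_on UNIV"
    and partial_s_comp_fst: "partial_s (\<lambda>x. \<phi> (fst x)) = (\<lambda>x. \<phi>' (fst x))"
    and partial_t_comp_fst: "partial_t (\<lambda>x. \<phi> (fst x)) = (\<lambda>x. 0)"
proof -
  have "\<phi> differentiable (at s)" for s using assms real_differentiable_def by blast
  then show "(\<lambda>x::real \<times> real. \<phi> (fst x)) differentiable_on UNIV"
    unfolding differentiable_on_def
    by (intro ballI, rule differentiable_compose[of \<phi>])
      (auto intro: bounded_linear_imp_differentiable bounded_linear_fst)
  show "partial_s (\<lambda>x. \<phi> (fst x)) = (\<lambda>x. \<phi>' (fst x))" "partial_t (\<lambda>x. \<phi> (fst x)) = (\<lambda>x. 0)"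
    using assms by (auto intro!: partial_s_eqI partial_t_eqI has_vector_derivative_const
        simp flip: has_real_derivative_iff_has_vector_derivative)
qed

lemma
  assumes "\<And>t. (\<psi> has_real_derivative \<psi>' t) (at t)"
  shows differentiable_comp_snd: "(\<lambda>x::real \<times> real. \<psi> (snd x)) differentiable_on UNIV"
    and partial_s_comp_snd: "partial_s (\<lambda>x. \<psi> (snd x)) = (\<lambda>x. 0)"
    and partial_t_comp_snd: "partial_t (\<lambda>x. \<psi> (snd x)) = (\<lambda>x. \<psi>' (snd x))"
proof -
  have "\<psi> differentiable (at s)" for s using assms real_differentiable_def by blast
  then show "(\<lambda>x::real \<times> real. \<psi> (snd x)) differentiable_on UNIV"
    unfolding differentiable_on_def
    by (intro ballI, rule differentiable_compose[of \<psi>])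
      (auto intro: bounded_linear_imp_differentiable bounded_linear_snd)
  show "partial_t (\<lambda>x. \<psi> (snd x)) = (\<lambda>x. \<psi>' (snd x))" "partial_s (\<lambda>x. \<psi> (snd x)) = (\<lambda>x. 0)"
    using assms by (auto intro!: partial_s_eqI partial_t_eqI has_vector_derivative_const
        simp flip: has_real_derivative_iff_has_vector_derivative)
qed

lemma partial_separated:
  assumes "\<And>s. (\<phi> has_real_derivative \<phi>' s) (at s)" "\<And>t. (\<psi> has_real_derivative \<psi>' t) (at t)"
  shows "partial_s (\<lambda>x. \<phi> (fst x) * \<psi> (snd x)) = (\<lambda>x. \<phi>' (fst x) * \<psi> (snd x))"
    and "partial_t (\<lambda>x. \<phi> (fst x) * \<psi> (snd x)) = (\<lambda>x. \<phi> (fst x) * \<psi>' (snd x))"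
proof -
  show "partial_s (\<lambda>x. \<phi> (fst x) * \<psi> (snd x)) = (\<lambda>x. \<phi>' (fst x) * \<psi> (snd x))"
    by (rule partial_s_eqI)
      (auto intro!: derivative_eq_intros assms simp flip: has_real_derivative_iff_has_vector_derivative)
  show "partial_t (\<lambda>x. \<phi> (fst x) * \<psi> (snd x)) = (\<lambda>x. \<phi> (fst x) * \<psi>' (snd x))"
    by (rule partial_t_eqI)
      (auto intro!: derivative_eq_intros assms simp flip: has_real_derivative_iff_has_vector_derivative)
qed

text \<open>For a conformal metric the area density equals the common coefficient, so it cancels
  inside the divergence. What remains is the flat Laplacian divided by the conformal factor.\<close>

lemma laplacian_separated:
  fixes u :: "real \<times> real \<Rightarrow> 'a::real_inner"
  assumes E: "metric_E u = (\<lambda>x. e (snd x))" and F: "metric_F u = (\<lambda>x. 0)"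
    and G: "metric_G u = (\<lambda>x. e (snd x))" and pos: "\<And>t. 0 < e t"
    and \<phi>: "\<And>s. (\<phi> has_real_derivative \<phi>' s) (at s)" "\<And>s. (\<phi>' has_real_derivative \<phi>'' s) (at s)"
    and \<psi>: "\<And>t. (\<psi> has_real_derivative \<psi>' t) (at t)" "\<And>t. (\<psi>' has_real_derivative \<psi>'' t) (at t)"
  shows "laplacian u (\<lambda>x. \<phi> (fst x) * \<psi> (snd x)) x
    = - (\<phi>'' (fst x) * \<psi> (snd x) + \<phi> (fst x) * \<psi>'' (snd x)) / e (snd x)"
proof -
  have "area_density u = (\<lambda>x. e (snd x))"
    using pos by (simp add: area_density_def[abs_def] E F G less_imp_le)
  then show ?thesis
    using pos by (simp add: laplacian_def E F G partial_separated[OF \<phi>(1) \<psi>(1)]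
        partial_separated[OF \<phi>(2) \<psi>(1)] partial_separated[OF \<phi>(1) \<psi>(2)] less_imp_neq[symmetric])
qed

section \<open>The minimal Legendrian tori\<close>

lemma cis_scaled_has_vector_derivative:
  "((\<lambda>s. cis (b * s)) has_vector_derivative complex_of_real b * (\<i> * cis (b * s))) (at s)"
proof -
  have "((\<lambda>s. b * s) has_derivative (\<lambda>x. x * b)) (at s)"
    by (auto intro!: derivative_eq_intros)
  from has_derivative_cis[OF this] show ?thesis
    by (simp add: has_vector_derivative_def scaleR_conv_of_real mult_ac)
qed

lemma inner_of_real_mult:
  fixes w z :: complex
  shows "(of_real x * w) \<bullet> (of_real y * z) = x * y * (w \<bullet> z)"
  by (simp add: inner_complex_def algebra_simps)

lemma cis_inner [simp]: "cis \<theta> \<bullet> cis \<theta> = 1" "(\<i> * cis \<theta>) \<bullet> (\<i> * cis \<theta>) = 1"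
  "(\<i> * cis \<theta>) \<bullet> cis \<theta> = 0" "cis \<theta> \<bullet> (\<i> * cis \<theta>) = 0"
  by (simp_all add: inner_complex_def flip: power2_eq_square)

locale legendrian_torus_params =
  fixes p q :: nat and P Q a r k c1 c2 c3 :: real
  assumes pq: "0 < p" "p < q" and coprime: "coprime p q"
  defines "P \<equiv> real p" and "Q \<equiv> real q" and "a \<equiv> P / Q"
    and "r \<equiv> sqrt ((Q + 2 * P) / Q)"
    and "k \<equiv> sqrt ((Q\<^sup>2 - P\<^sup>2) / (Q * (Q + 2 * P)))"
    and "c1 \<equiv> sqrt ((Q + P) / (2 * Q + P))"
    and "c2 \<equiv> sqrt ((Q + P) / (Q + 2 * P))"
    and "c3 \<equiv> sqrt (Q / (2 * Q + P))"
begin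

abbreviation "sn \<equiv> jacobi_sn k"
abbreviation "cn \<equiv> jacobi_cn k"
abbreviation "dn \<equiv> jacobi_dn k"

lemma PQ: "0 < P" "P < Q" "0 < Q" using pq by (auto simp: P_def Q_def)

lemma a_bounds: "0 < a" "a < 1" using PQ by (auto simp: a_def)

lemma P_eq: "P = a * Q" using PQ by (simp add: a_def)

lemma r_pos: "0 < r" and c_pos: "0 < c1" "0 < c2" "0 < c3"
  using PQ by (auto simp: r_def c1_def c2_def c3_def)

lemma r_squared: "r\<^sup>2 = 1 + 2 * a"
  using PQ by (simp add: r_def a_def add_divide_distrib)

lemma k_squared: "k\<^sup>2 = (1 - a\<^sup>2) / (1 + 2 * a)"
proof -
  have "P\<^sup>2 \<le> Q\<^sup>2" using PQ by (intro power_mono) auto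
  then have "k\<^sup>2 = (Q\<^sup>2 - P\<^sup>2) / (Q * (Q + 2 * P))" using PQ by (simp add: k_def)
  also have "\<dots> = (Q\<^sup>2 * (1 - a\<^sup>2)) / (Q\<^sup>2 * (1 + 2 * a))"
    unfolding P_eq by (simp add: algebra_simps power2_eq_square)
  finally show ?thesis using PQ by simp
qed

lemma c_squared: "c1\<^sup>2 = (1 + a) / (2 + a)" "c2\<^sup>2 = (1 + a) / (1 + 2 * a)" "c3\<^sup>2 = 1 / (2 + a)"
proof -
  have "c1\<^sup>2 = (Q * (1 + a)) / (Q * (2 + a))" "c2\<^sup>2 = (Q * (1 + a)) / (Q * (1 + 2 * a))"
    "c3\<^sup>2 = (Q * 1) / (Q * (2 + a))"
    using PQ a_bounds unfolding c1_def c2_def c3_def P_eq by (simp_all add: algebra_simps)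
  then show "c1\<^sup>2 = (1 + a) / (2 + a)" "c2\<^sup>2 = (1 + a) / (1 + 2 * a)" "c3\<^sup>2 = 1 / (2 + a)"
    using PQ by simp_all
qed

lemma k_squared_less_1: "k\<^sup>2 < 1"
proof -
  have "1 - a\<^sup>2 < 1 + 2 * a" using a_bounds zero_le_power2[of a] by linarith
  then show ?thesis using a_bounds by (simp add: k_squared)
qed

text \<open>Each coordinate is a real amplitude times \<open>cis\<close> or
  \<open>\<i> * cis\<close>. Differentiation in s turns the unit vector by a right angle and
  differentiation in t changes only the amplitude, so \<open>metric_F\<close> vanishes coordinate by
  coordinate. The factor in \<open>cis (1 * s)\<close> fits the rule for scaled arguments.\<close>

lemma torus_eq:
  "legendrian_torus p q (s, t) =
     (of_real (c1 * cn (r * t)) * cis (1 * s),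
      of_real (c2 * sn (r * t)) * (\<i> * cis (a * s)),
      of_real (c3 * dn (r * t)) * cis (- (1 + a) * s))"
  by (simp add: legendrian_torus_def Let_def r_def k_def c1_def c2_def c3_def a_def P_def Q_def mult_ac)

section \<open>First derivatives of the immersion and the induced metric\<close>

lemma partial_s_torus:
  "partial_s (legendrian_torus p q) (s, t) =
     (of_real (c1 * cn (r * t)) * (\<i> * cis s),
      of_real (- (c2 * a * sn (r * t))) * cis (a * s),
      of_real (- (c3 * (1 + a) * dn (r * t))) * (\<i> * cis (- (1 + a) * s)))"
proof -
  have "((\<lambda>s. legendrian_torus p q (s, t)) has_vector_derivative
      (of_real (c1 * cn (r * t)) * (of_real 1 * (\<i> * cis (1 * s))),
       of_real (c2 * sn (r * t)) * (\<i> * (of_real a * (\<i> * cis (a * s)))),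
       of_real (c3 * dn (r * t)) * (of_real (- (1 + a)) * (\<i> * cis (- (1 + a) * s))))) (at s)"
    unfolding torus_eq
    by (intro has_vector_derivative_Pair has_vector_derivative_mult_right
        cis_scaled_has_vector_derivative)
  then show ?thesis
    unfolding partial_s_def prod.case
    by (subst vector_derivative_at) (auto simp: algebra_simps)
qed

lemma partial_t_torus:
  "partial_t (legendrian_torus p q) (s, t) =
     (of_real (- (c1 * r * sn (r * t) * dn (r * t))) * cis s,
      of_real (c2 * r * cn (r * t) * dn (r * t)) * (\<i> * cis (a * s)),
      of_real (- (c3 * r * k\<^sup>2 * sn (r * t) * cn (r * t))) * cis (- (1 + a) * s))"
proof -
  have chain: "((\<lambda>t. of_real (c * f (r * t)) * z) has_vector_derivative of_real (c * (f' (r * t) * r)) * z) (at t)"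
    if "\<And>x. (f has_real_derivative f' x) (at x)" for c :: real and f f' and z :: complex
  proof -
    have "((\<lambda>t. c * f (r * t)) has_real_derivative c * (f' (r * t) * r)) (at t)"
      by (rule DERIV_cmult, rule DERIV_chain2[OF that]) (auto intro!: derivative_eq_intros)
    then show ?thesis
      by (intro has_vector_derivative_mult_left has_vector_derivative_of_real)
  qed
  have "((\<lambda>t. legendrian_torus p q (s, t)) has_vector_derivative
      (of_real (c1 * ((- sn (r * t) * dn (r * t)) * r)) * cis (1 * s),
       of_real (c2 * ((cn (r * t) * dn (r * t)) * r)) * (\<i> * cis (a * s)),
       of_real (c3 * ((- k\<^sup>2 * sn (r * t) * cn (r * t)) * r)) * cis (- (1 + a) * s))) (at t)"
    unfolding torus_eq
    by (intro has_vector_derivative_Pair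
        chain[where f' = "\<lambda>x. - sn x * dn x"] chain[where f' = "\<lambda>x. cn x * dn x"]
        chain[where f' = "\<lambda>x. - k\<^sup>2 * sn x * cn x"]
        sn_has_deriv cn_has_deriv dn_has_deriv k_squared_less_1)
  then show ?thesis
    unfolding partial_t_def prod.case
    by (subst vector_derivative_at) (auto simp: algebra_simps)
qed

definition conformal_factor :: "real \<Rightarrow> real" where
  "conformal_factor t = (1 + a) - (1 - a\<^sup>2) * (sn (r * t))\<^sup>2"

lemma metric_E_torus: "metric_E (legendrian_torus p q) = (\<lambda>x. conformal_factor (snd x))"
proof
  fix x :: "real \<times> real"
  obtain s t where x: "x = (s, t)" by fastforce
  define y where "y = (sn (r * t))\<^sup>2"
  \<comment> \<open>The reciprocals become unknowns subject to the polynomial relations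
    \<open>AB\<close>, which turns the final identity into one that \<open>algebra\<close> can
    decide.\<close>
  define A where "A = 1 / (2 + a)"
  define B where "B = 1 / (1 + 2 * a)"
  have AB: "A * (2 + a) = 1" "B * (1 + 2 * a) = 1" using a_bounds by (auto simp: A_def B_def)
  have sq: "(cn (r * t))\<^sup>2 = 1 - y" "(dn (r * t))\<^sup>2 = 1 - k\<^sup>2 * y" "(sn (r * t))\<^sup>2 = y"
    using sn_cn_squared[OF k_squared_less_1, of "r * t"] dn_squared[OF k_squared_less_1, of "r * t"] by (auto simp: y_def)
  have "metric_E (legendrian_torus p q) x = c1\<^sup>2 * (cn (r * t))\<^sup>2 + c2\<^sup>2 * a\<^sup>2 * (sn (r * t))\<^sup>2
      + c3\<^sup>2 * (1 + a)\<^sup>2 * (dn (r * t))\<^sup>2"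
    unfolding metric_E_def x partial_s_torus inner_prod_def fst_conv snd_conv inner_of_real_mult cis_inner
    by (simp add: power2_eq_square algebra_simps)
  also have "\<dots> = (1 + a) * A * (1 - y) + (1 + a) * B * a\<^sup>2 * y
      + A * (1 + a)\<^sup>2 * (1 - (1 - a\<^sup>2) * B * y)"
    by (simp add: sq c_squared k_squared A_def B_def)
  also have "\<dots> = (1 + a) - (1 - a\<^sup>2) * y"
    using AB by algebra
  finally show "metric_E (legendrian_torus p q) x = conformal_factor (snd x)"
    by (simp add: conformal_factor_def x y_def)
qed

lemma metric_F_torus: "metric_F (legendrian_torus p q) = (\<lambda>x. 0)"
proof
  fix x :: "real \<times> real"
  obtain s t where x: "x = (s, t)" by fastforce
  show "metric_F (legendrian_torus p q) x = 0"
    unfolding metric_F_def x partial_s_torus partial_t_torus inner_prod_def fst_conv snd_conv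
      inner_of_real_mult cis_inner by simp
qed

text \<open>The same function as for \<open>metric_E\<close>: this is conformality, and it depends
  on the particular values of \<open>r\<close>, \<open>k\<close>, \<open>c1\<close>,
  \<open>c2\<close>, \<open>c3\<close>.\<close>

lemma metric_G_torus: "metric_G (legendrian_torus p q) = (\<lambda>x. conformal_factor (snd x))"
proof
  fix x :: "real \<times> real"
  obtain s t where x: "x = (s, t)" by fastforce
  define y where "y = (sn (r * t))\<^sup>2"
  define A where "A = 1 / (2 + a)"
  define B where "B = 1 / (1 + 2 * a)"
  have AB: "A * (2 + a) = 1" "B * (1 + 2 * a) = 1" using a_bounds by (auto simp: A_def B_def)
  have sq: "(cn (r * t))\<^sup>2 = 1 - y" "(dn (r * t))\<^sup>2 = 1 - k\<^sup>2 * y" "(sn (r * t))\<^sup>2 = y"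
    using sn_cn_squared[OF k_squared_less_1, of "r * t"] dn_squared[OF k_squared_less_1, of "r * t"] by (auto simp: y_def)
  have "metric_G (legendrian_torus p q) x = r\<^sup>2 * (c1\<^sup>2 * (sn (r * t))\<^sup>2 * (dn (r * t))\<^sup>2
      + c2\<^sup>2 * (cn (r * t))\<^sup>2 * (dn (r * t))\<^sup>2 + c3\<^sup>2 * (k\<^sup>2)\<^sup>2 * (sn (r * t))\<^sup>2 * (cn (r * t))\<^sup>2)"
    unfolding metric_G_def x partial_t_torus inner_prod_def fst_conv snd_conv inner_of_real_mult cis_inner
    by (simp add: power2_eq_square algebra_simps)
  also have "\<dots> = (1 + 2 * a) * ((1 + a) * A * y * (1 - (1 - a\<^sup>2) * B * y)
      + (1 + a) * B * (1 - y) * (1 - (1 - a\<^sup>2) * B * y)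
      + A * ((1 - a\<^sup>2) * B)\<^sup>2 * y * (1 - y))"
    unfolding sq c_squared k_squared r_squared A_def B_def by simp
  also have "\<dots> = (1 + a) - (1 - a\<^sup>2) * y"
    using AB by algebra
  finally show "metric_G (legendrian_torus p q) x = conformal_factor (snd x)"
    by (simp add: conformal_factor_def x y_def)
qed

text \<open>The bound is the value at sn^2 = 1. Its factor 1 + a > 1 is what makes the final
  eigenvalue estimate strict.\<close>

lemma conformal_factor_ge: "a * (1 + a) \<le> conformal_factor t"
proof -
  have "(1 - a\<^sup>2) * (sn (r * t))\<^sup>2 \<le> (1 - a\<^sup>2) * 1"
    using a_bounds by (intro mult_left_mono) (auto simp: abs_square_le_1 jacobi_sn_def power_le_one)
  then show ?thesis by (simp add: conformal_factor_def algebra_simps power2_eq_square)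
qed

lemma conformal_factor_le: "conformal_factor t \<le> 1 + a"
  using a_bounds by (simp add: conformal_factor_def power_le_one)

lemma continuous_conformal_factor: "continuous_on UNIV conformal_factor"
proof -
  have "continuous_on UNIV sn"
    using DERIV_isCont[OF sn_has_deriv[OF k_squared_less_1]] continuous_at_imp_continuous_on by blast
  then have "continuous_on UNIV (\<lambda>t. sn (r * t))"
    by (rule continuous_on_compose2) (auto intro!: continuous_intros)
  then show ?thesis unfolding conformal_factor_def[abs_def] by (intro continuous_intros)
qed

lemma conformal_factor_minus: "conformal_factor (- t) = conformal_factor t"
  by (simp add: conformal_factor_def sn_minus[OF k_squared_less_1])

text \<open>Reflection of the argument and a shift by 2K(k) only change the sign of
  \<open>sn\<close>, which enters squared. Hence K(k)/r is an axis of symmetry besides 0.\<close>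

lemma conformal_factor_reflect: "conformal_factor (2 * (elliptic_K k / r) - t) = conformal_factor t"
proof -
  have "r * (2 * (elliptic_K k / r) - t) = - (r * t) + 2 * of_int 1 * elliptic_K k"
    using r_pos by (simp add: field_simps)
  then have "sn (r * (2 * (elliptic_K k / r) - t)) = cos (of_int 1 * pi) * sn (- (r * t))"
    by (simp only: sn_add[OF k_squared_less_1 refl])
  then show ?thesis by (simp add: conformal_factor_def sn_minus[OF k_squared_less_1])
qed


text \<open>The first two coordinates at two points suffice. They show that \<tau> is j times
  2K(k)/r and that \<open>cis \<sigma>\<close> and \<open>cis (a * \<sigma>)\<close> both equal
  (-1)^j. So \<sigma> = l \<pi> and a \<sigma> = l' \<pi> with l and l' of the parity of j, and
  coprimality turns p l = q l' into l = q m, l' = p m.\<close>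

lemma period_lattice_torus:
  assumes "(\<sigma>, \<tau>) \<in> period_lattice (legendrian_torus p q)"
  obtains j m :: int where "\<tau> = of_int j * (2 * (elliptic_K k / r))" "\<sigma> = of_int m * Q * pi"
    "even q \<longrightarrow> even m"
proof -
  have period: "legendrian_torus p q (s + \<sigma>, t + \<tau>) = legendrian_torus p q (s, t)" for s t
    using assms by (auto simp: period_lattice_def)
  have am0: "sn 0 = 0" "cn 0 = 1" "sn (elliptic_K k) = 1"
    by (simp_all add: jacobi_sn_def jacobi_cn_def am_0[OF k_squared_less_1] elliptic_K_def am_F[OF k_squared_less_1])
  have "sn (r * \<tau>) = 0"
    using period[of 0 0] c_pos by (simp add: torus_eq am0)
  then obtain j :: int where j: "jacobi_am k (r * \<tau>) = of_int j * pi"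
    by (auto simp: jacobi_sn_def sin_zero_iff_int2)
  then have r\<tau>: "r * \<tau> = 2 * of_int j * elliptic_K k"
    using F_am[OF k_squared_less_1, of "r * \<tau>"] elliptic_F_add_int_pi[OF k_squared_less_1, of 0 j] elliptic_F_0[OF k_squared_less_1] by simp
  define \<epsilon> :: real where "\<epsilon> = cos (of_int j * pi)"
  have \<epsilon>: "\<epsilon> = (if even j then 1 else -1)"
    using cos_npi_int[of j] by (simp add: \<epsilon>_def mult.commute)
  have "cn (r * \<tau>) = \<epsilon>"
    using cn_add[OF k_squared_less_1 \<epsilon>_def, of 0] by (simp add: r\<tau> am0)
  then have "cis \<sigma> * of_real \<epsilon> = 1"
    using period[of 0 0] c_pos by (simp add: torus_eq am0 mult.commute)
  then have "cis \<sigma> = of_real \<epsilon>" by (auto simp: \<epsilon> minus_equation_iff split: if_splits)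
  then have \<sigma>: "sin \<sigma> = 0" "cos \<sigma> = \<epsilon>" by (auto simp: complex_eq_iff)
  \<comment> \<open>The second coordinate vanishes at the origin and gives no information on a
    \<sigma> there; at t = K(k)/r it does, because \<open>sn\<close> is 1.\<close>
  have "r * (elliptic_K k / r + \<tau>) = elliptic_K k + 2 * of_int j * elliptic_K k"
    using r\<tau> r_pos by (simp add: distrib_left)
  then have "sn (r * (elliptic_K k / r + \<tau>)) = \<epsilon>"
    using sn_add[OF k_squared_less_1 \<epsilon>_def, of "elliptic_K k"] by (simp only: am0)
  then have "cis (a * \<sigma>) * of_real \<epsilon> = 1"
    using period[of 0 "elliptic_K k / r"] c_pos r_pos by (simp add: torus_eq am0 mult.commute)
  then have "cis (a * \<sigma>) = of_real \<epsilon>" by (auto simp: \<epsilon> minus_equation_iff split: if_splits)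
  then have a\<sigma>: "sin (a * \<sigma>) = 0" "cos (a * \<sigma>) = \<epsilon>" by (auto simp: complex_eq_iff)
  obtain l l' :: int where l: "\<sigma> = of_int l * pi" and l': "a * \<sigma> = of_int l' * pi"
    using \<sigma>(1) a\<sigma>(1) by (auto simp: sin_zero_iff_int2)
  have "cos (pi * of_int l) = \<epsilon>" "cos (pi * of_int l') = \<epsilon>"
    using \<sigma>(2) a\<sigma>(2) by (metis l mult.commute, metis l' mult.commute)
  then have "even l = even j" "even l' = even j"
    unfolding cos_npi_int \<epsilon> by (auto split: if_splits)
  have "a * of_int l = of_int l'" using l l' by simp
  then have "real_of_int (int p * l) = real_of_int (int q * l')"
    using PQ by (simp add: a_def P_def Q_def field_simps)
  then have pl: "int p * l = int q * l'" by (simp only: of_int_eq_iff)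
  have cop: "coprime (int p) (int q)" using coprime by simp
  have "int q dvd l"
    using pl cop by (metis coprime_commute coprime_dvd_mult_right_iff dvd_triv_left)
  then obtain m where m: "l = int q * m" by blast
  then have "int q * (int p * m) = int q * l'" using pl by (simp add: mult_ac)
  then have "l' = int p * m" using pq by simp
  have "even q \<longrightarrow> even m"
  proof
    assume "even q"
    then have "odd p" using coprime by (metis coprime_common_divisor odd_one)
    have "even l" using m \<open>even q\<close> by simp
    then have "even (int p * m)" using \<open>even l = even j\<close> \<open>even l' = even j\<close> \<open>l' = int p * m\<close> by simp
    then show "even m" using \<open>odd p\<close> by simp
  qed
  moreover have "\<tau> = of_int j * (2 * (elliptic_K k / r))" using r\<tau> r_pos by (simp add: field_simps)
  moreover have "\<sigma> = of_int m * Q * pi" using l m by (simp add: Q_def)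
  ultimately show thesis using that by blast
qed

text \<open>The frequency is \<omega> = c/q, so a period with first component m q \<pi> moves the
  phase by c m \<pi>. The hypothesis on c makes c m even: c = 1 serves even q, where m is even, and
  c = 2 serves odd q.\<close>

lemma lambda1_torus_less:
  fixes c :: nat
  assumes c: "0 < c" "even q \<or> even c"
  shows "lambda1_torus p q < (real c)\<^sup>2 / (P * Q)"
proof -
  define \<omega> where "\<omega> = real c / Q"
  define h where "h = elliptic_K k / r"
  have "0 < h" "0 < \<omega>" using elliptic_K_pos[OF k_squared_less_1] r_pos c PQ by (auto simp: h_def \<omega>_def)
  have "0 < a * (1 + a)" using a_bounds by simp
  obtain \<mu> g g' where \<mu>: "0 < \<mu>" "\<mu> \<le> \<omega>\<^sup>2 / (a * (1 + a))" and g0: "g 0 = 1"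
    and per: "\<And>t. g (t + 2 * h) = g t"
    and dg: "\<And>t. (g has_real_derivative g' t) (at t)"
    and dg': "\<And>t. (g' has_real_derivative (\<omega>\<^sup>2 - \<mu> * conformal_factor t) * g t) (at t)"
    using periodic_hill_solution_exists[OF continuous_conformal_factor \<open>0 < a * (1 + a)\<close>
        conformal_factor_ge conformal_factor_le \<open>0 < h\<close> \<open>0 < \<omega>\<close> conformal_factor_minus
        conformal_factor_reflect[folded h_def]] by metis
  have dcos: "((\<lambda>s. cos (\<omega> * s)) has_real_derivative - \<omega> * sin (\<omega> * s)) (at s)" for s
    by (auto intro!: derivative_eq_intros)
  have dsin: "((\<lambda>s. sin (\<omega> * s)) has_real_derivative \<omega> * cos (\<omega> * s)) (at s)" for s
    by (auto intro!: derivative_eq_intros)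
  have dr: "((\<lambda>t. f (r * t)) has_real_derivative f' (r * t) * r) (at t)"
    if "\<And>x. (f has_real_derivative f' x) (at x)" for f f' t
    by (rule DERIV_chain2[OF that]) (auto intro!: derivative_eq_intros)
  note dsn = dr[OF sn_has_deriv[OF k_squared_less_1]] and dcn = dr[OF cn_has_deriv[OF k_squared_less_1]]
    and ddn = dr[OF dn_has_deriv[OF k_squared_less_1]]
  define f where "f = (\<lambda>x::real \<times> real. cos (\<omega> * fst x) * g (snd x))"

  \<comment> \<open>\<open>cos\<close> and \<open>sin\<close> close up under differentiation in s,
    and g, g' under differentiation in t through the Hill equation. The coefficient of that equation
    is a polynomial in \<open>sn\<close>, which brings in \<open>cn\<close> and
    \<open>dn\<close>.\<close>
  define B :: "(real \<times> real \<Rightarrow> real) set" where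
    "B = {\<lambda>x. cos (\<omega> * fst x), \<lambda>x. sin (\<omega> * fst x), \<lambda>x. g (snd x), \<lambda>x. g' (snd x),
       \<lambda>x. sn (r * snd x), \<lambda>x. cn (r * snd x), \<lambda>x. dn (r * snd x)}"
  note alg = function_algebra.intros(2-)
  have base: "(\<lambda>x. cos (\<omega> * fst x)) \<in> function_algebra B" "(\<lambda>x. sin (\<omega> * fst x)) \<in> function_algebra B"
    "(\<lambda>x. g (snd x)) \<in> function_algebra B" "(\<lambda>x. g' (snd x)) \<in> function_algebra B"
    "(\<lambda>x. sn (r * snd x)) \<in> function_algebra B" "(\<lambda>x. cn (r * snd x)) \<in> function_algebra B"
    "(\<lambda>x. dn (r * snd x)) \<in> function_algebra B"
    by (auto intro!: function_algebra.base simp: B_def)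
  \<comment> \<open>The coefficient is rewritten with sums, products and constants only, the shapes
    that the introduction rules of the algebra recognise.\<close>
  have "(\<lambda>x::real \<times> real. (\<omega>\<^sup>2 - \<mu> * conformal_factor (snd x)) * g (snd x))
      = (\<lambda>x::real \<times> real. (\<omega>\<^sup>2 - \<mu> * (1 + a) + \<mu> * (1 - a\<^sup>2) * (sn (r * snd x) * sn (r * snd x))) * g (snd x))"
    by (simp add: conformal_factor_def algebra_simps power2_eq_square)
  moreover have "\<dots> \<in> function_algebra B" by (intro alg base)
  ultimately have hill: "(\<lambda>x::real \<times> real. (\<omega>\<^sup>2 - \<mu> * conformal_factor (snd x)) * g (snd x)) \<in> function_algebra B"
    by simp
  have "smooth f"
  proof (rule smooth_function_algebra)
    show "f \<in> function_algebra B" unfolding f_def by (intro alg base)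
    fix b assume "b \<in> B"
    then consider "b = (\<lambda>x. cos (\<omega> * fst x))" | "b = (\<lambda>x. sin (\<omega> * fst x))" | "b = (\<lambda>x. g (snd x))"
      | "b = (\<lambda>x. g' (snd x))" | "b = (\<lambda>x. sn (r * snd x))" | "b = (\<lambda>x. cn (r * snd x))"
      | "b = (\<lambda>x. dn (r * snd x))"
      by (auto simp: B_def)
    then show "b differentiable_on UNIV \<and>
      partial_s b \<in> function_algebra B \<and> partial_t b \<in> function_algebra B"
    proof cases
      case 1
      show ?thesis
        unfolding 1 partial_s_comp_fst[OF dcos] partial_t_comp_fst[OF dcos]
        by (intro conjI differentiable_comp_fst[OF dcos] alg base)
    next
      case 2
      show ?thesis
        unfolding 2 partial_s_comp_fst[OF dsin] partial_t_comp_fst[OF dsin]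
        by (intro conjI differentiable_comp_fst[OF dsin] alg base)
    next
      case 3
      show ?thesis
        unfolding 3 partial_s_comp_snd[OF dg] partial_t_comp_snd[OF dg]
        by (intro conjI differentiable_comp_snd[OF dg] alg base)
    next
      case 4
      show ?thesis
        unfolding 4 partial_s_comp_snd[OF dg'] partial_t_comp_snd[OF dg']
        by (intro conjI differentiable_comp_snd[OF dg'] function_algebra.const hill)
    next
      case 5
      show ?thesis
        unfolding 5 partial_s_comp_snd[OF dsn] partial_t_comp_snd[OF dsn]
        by (intro conjI differentiable_comp_snd[OF dsn] alg base)
    next
      case 6
      have "(\<lambda>x. - sn (r * snd x) * dn (r * snd x) * r)
          = (\<lambda>x::real \<times> real. (- r) * (sn (r * snd x) * dn (r * snd x)))" by (simp add: mult_ac)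
      moreover have "\<dots> \<in> function_algebra B" by (intro alg base)
      ultimately show ?thesis
        unfolding 6 partial_s_comp_snd[OF dcn] partial_t_comp_snd[OF dcn]
        using differentiable_comp_snd[OF dcn] by (simp only: function_algebra.const simp_thms)
    next
      case 7
      show ?thesis
        unfolding 7 partial_s_comp_snd[OF ddn] partial_t_comp_snd[OF ddn]
        by (intro conjI differentiable_comp_snd[OF ddn] alg base)
    qed
  qed

  have per_int: "g (t + of_int j * (2 * h)) = g t" for t j
  proof (induction j rule: int_induct[where k = 0])
    case (step1 i)
    then show ?case using per[of "t + of_int i * (2 * h)"] by (simp add: algebra_simps)
  next
    case (step2 i)
    then show ?case using per[of "t + of_int (i - 1) * (2 * h)"] by (simp add: algebra_simps)
  qed simp
  have "f (x + v) = f x" if v: "v \<in> period_lattice (legendrian_torus p q)" for v x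
  proof -
    obtain j m where jm: "snd v = of_int j * (2 * h)" "fst v = of_int m * Q * pi" "even q \<longrightarrow> even m"
      using period_lattice_torus[of "fst v" "snd v"] v by (auto simp: h_def)
    have "\<omega> * fst v = pi * of_int (int c * m)"
      using PQ by (simp add: jm \<omega>_def)
    moreover have "even (int c * m)" using jm c by auto
    ultimately have "cos (\<omega> * fst v) = 1" "sin (\<omega> * fst v) = 0"
      using cos_npi_int[of "int c * m"] by (simp_all add: sin_zero_iff_int2) (metis mult.commute of_int_mult of_int_of_nat_eq)
    then have "cos (\<omega> * fst (x + v)) = cos (\<omega> * fst x)" by (simp add: distrib_left cos_add)
    then show ?thesis using per_int[of "snd x" j] by (simp add: f_def jm)
  qed
  then have "f \<in> torus_functions (legendrian_torus p q)"
    using \<open>smooth f\<close> by (simp add: torus_functions_def)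
  moreover have "laplacian (legendrian_torus p q) f x = \<mu> * f x" for x
  proof -
    have pos: "0 < conformal_factor t" for t
      using conformal_factor_ge[of t] \<open>0 < a * (1 + a)\<close> by linarith
    have d2: "((\<lambda>s. - \<omega> * sin (\<omega> * s)) has_real_derivative - \<omega>\<^sup>2 * cos (\<omega> * s)) (at s)" for s
      by (auto intro!: derivative_eq_intros simp: power2_eq_square)
    show ?thesis
      unfolding f_def laplacian_separated[OF metric_E_torus metric_F_torus metric_G_torus pos dcos d2 dg dg']
      using pos[of "snd x"] by (simp add: field_simps)
  qed
  moreover have "f (0, 0) \<noteq> 0" by (simp add: f_def g0)
  ultimately have "laplace_eigenvalue (legendrian_torus p q) \<mu>"
    unfolding laplace_eigenvalue_def by blast
  then have "lambda1_torus p q \<le> \<mu>"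
    unfolding lambda1_torus_def first_nonzero_eigenvalue_def
    using \<mu> by (intro cInf_lower bdd_belowI[of _ 0]) auto
  also have "\<dots> \<le> \<omega>\<^sup>2 / (a * (1 + a))" by (rule \<mu>)
  also have "\<dots> < \<omega>\<^sup>2 / a" using \<open>0 < \<omega>\<close> a_bounds by (intro divide_strict_left_mono) auto
  also have "\<dots> = (real c)\<^sup>2 / (P * Q)"
    using PQ by (simp add: \<omega>_def a_def power2_eq_square)
  finally show ?thesis .
qed

end

theorem corollary6p5:
  shows "(\<forall>m n :: nat. 0 < m \<and> m < 2 * n \<and> coprime m (2 * n) \<longrightarrow>
            lambda1_torus m (2 * n) < 1 / real n) \<and>
         (\<forall>m n :: nat. 0 < 2 * m + 1 \<and> 2 * m + 1 < 2 * n + 1 \<and>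
            coprime (2 * m + 1) (2 * n + 1) \<longrightarrow>
            lambda1_torus (2 * m + 1) (2 * n + 1) < 4 / real (2 * n + 1))"
proof -
  have bound: "lambda1_torus p q < (real c)\<^sup>2 / real q"
    if "0 < p" "p < q" "coprime p q" "0 < c" "even q \<or> even c" for p q c
  proof -
    interpret legendrian_torus_params p q "real p" "real q" "real p / real q"
      "sqrt ((real q + 2 * real p) / real q)"
      "sqrt (((real q)\<^sup>2 - (real p)\<^sup>2) / (real q * (real q + 2 * real p)))"
      "sqrt ((real q + real p) / (2 * real q + real p))"
      "sqrt ((real q + real p) / (real q + 2 * real p))"
      "sqrt (real q / (2 * real q + real p))"
      using that by unfold_locales auto
    have "lambda1_torus p q < (real c)\<^sup>2 / (real p * real q)"
      using lambda1_torus_less[of c] that by simp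
    also have "\<dots> \<le> (real c)\<^sup>2 / (1 * real q)"
      using that by (intro divide_left_mono mult_right_mono) auto
    finally show ?thesis by simp
  qed
  show ?thesis
  proof (intro conjI allI impI)
    fix m n :: nat
    assume "0 < m \<and> m < 2 * n \<and> coprime m (2 * n)"
    \<comment> \<open>With c = 1 and q = 2n the estimate is 1/(2n), half of the claimed
      bound.\<close>
    then have "lambda1_torus m (2 * n) < 1 / (2 * real n)" "0 < n"
      using bound[of m "2 * n" 1] by auto
    then show "lambda1_torus m (2 * n) < 1 / real n"
      by (smt (verit) frac_less2 of_nat_0_less_iff)
  next
    fix m n :: nat
    assume "0 < 2 * m + 1 \<and> 2 * m + 1 < 2 * n + 1 \<and> coprime (2 * m + 1) (2 * n + 1)"
    then show "lambda1_torus (2 * m + 1) (2 * n + 1) < 4 / real (2 * n + 1)"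
      using bound[of "2 * m + 1" "2 * n + 1" 2] by simp
  qed
qed

end
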